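(* Let $\Omega\subseteq\mathbb{R}^k$ be open. For every bounded sequence $\{z_n\}_{n\in\mathbb{N}}$ in $L^1(\Omega)$ such that (i) $z_n$ converges weakly-$\star$ to $z_\infty$ in $C^0_c(\Omega)'$, and (ii) $z_n$ converges to $\nu$ in the sense of Young measures, where $\nu:\Omega\to\mathbb{M}^{\mathbb{P}}(\mathbb{R})$ is a Young measure, there exists a (non unique) grid function $z\in\mathbb{G}(\Omega)$ such that (1) for all $\varphi\in C^0_c(\Omega)$, $$\langle z,{}^*\varphi\rangle\approx\langle z_\infty,\varphi\rangle_{C^0_c(\Omega)};$$ (2) for all $g\in C^0_b(\mathbb{R})$ and for all $\varphi\in C^0_c(\Omega)$, $$\langle {}^*g(z),{}^*\varphi\rangle\approx\int_\Omega\left(\int_{\mathbb{R}}g\,d\nu_x\right)\varphi(x)\,dx.$$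
   Context: Nonstandard setting: ${}^*\mathbb{R}$ is a $|\mathscr{D}(\Omega)'|$-saturated hyperreal field in Robinson's nonstandard analysis, where $\mathscr{D}(\Omega)'$ is the space of real distributions over the open set $\Omega\subseteq\mathbb{R}^k$. For $x,y\in{}^*\mathbb{R}$, $x\approx y$ means that $x-y$ is infinitesimal. Grid functions: fix an infinite hypernatural $N_0$, set $N=N_0!$, $\varepsilon=1/N$, $\mathbb{X}=\{n\varepsilon : n\in[-N^2,N^2]\cap{}^*\mathbb{Z}\}$, and $\Omega_{\mathbb{X}}={}^*\Omega\cap\mathbb{X}^k$ (a hyperfinite set). The space of grid functions is $\mathbb{G}(\Omega)=\{f:\Omega_{\mathbb{X}}\to{}^*\mathbb{R} : f\text{ is internal}\}$. For internal $f,h$ defined on $\Omega_{\mathbb{X}}$ (functions on ${}^*\Omega$ are restricted to $\Omega_{\mathbb{X}}$), $\langle f,h\rangle=\varepsilon^k\sum_{x\in\Omega_{\mathbb{X}}}f(x)h(x)$. ${}^*g(z)$ denotes the grid function $x\mapsto{}^*g(z(x))$. Function spaces: $C^0_b(\mathbb{R})=\{g\in C^0(\mathbb{R}) : g\text{ bounded and }\lim_{|x|\to\infty}g(x)=0\}$. $C^0_c(\Omega)$ is the space of continuous real functions with compact support in $\Omega$, with the supremum norm; $C^0_c(\Omega)'$ is its dual, with duality $\langle\cdot,\cdot\rangle_{C^0_c(\Omega)}$. A function $w\in L^1(\Omega)$ is regarded as the element $\varphi\mapsto\int_\Omega w\varphi\,dx$ of $C^0_c(\Omega)'$. Young measures: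 $\mathbb{M}^{\mathbb{P}}(\mathbb{R})$ is the set of Radon probability measures on $\mathbb{R}$. A Young measure is a measurable map $\nu:\Omega\to\mathbb{M}^{\mathbb{P}}(\mathbb{R})$, $x\mapsto\nu_x$ (that is, $x\mapsto\int_{\mathbb{R}} g\,d\nu_x$ is measurable for all $g\in C^0_b(\mathbb{R})$). A bounded sequence $\{z_n\}$ in $L^1(\Omega)$ converges to $\nu$ in the sense of Young measures if for all $g\in C^0_b(\mathbb{R})$ and all $\varphi\in C^0_c(\Omega)$, $$\lim_{n\to\infty}\int_\Omega g(z_n(x))\varphi(x)\,dx=\int_\Omega\left(\int_{\mathbb{R}}g\,d\nu_x\right)\varphi(x)\,dx.$$ *)

theory Defs
  imports "HOL-Probability.Probability"
begin

section \<open>Nonstandard extensions\<close>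

text \<open>
  A nonstandard extension of a universe of standard objects is an elementary extension of the full
  structure on that universe, i.e. of the structure having every finitary relation as a primitive.
  Relations are sets of argument lists. Because every standard relation has a name, the transfer
  principle is the preservation of all first-order formulas over these names. \<open>std\<close> is the map
  sending a standard object \<open>a\<close> to \<open>*a\<close>, and \<open>ext\<close> sends a standard relation \<open>R\<close> to \<open>*R\<close>. The
  type \<open>'n\<close> consists of the internal objects.
\<close>

datatype 's form =
    Atom "'s list set" "nat list"
  | Equal nat nat
  | Neg "'s form"
  | Conj "'s form" "'s form"
  | All nat "'s form"

primrec sat :: "('s list set \<Rightarrow> 'a list set) \<Rightarrow> 's form \<Rightarrow> (nat \<Rightarrow> 'a) \<Rightarrow> bool" where
  "sat I (Atom R xs) e \<longleftrightarrow> map e xs \<in> I R"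
| "sat I (Equal x y) e \<longleftrightarrow> e x = e y"
| "sat I (Neg p) e \<longleftrightarrow> \<not> sat I p e"
| "sat I (Conj p q) e \<longleftrightarrow> sat I p e \<and> sat I q e"
| "sat I (All x p) e \<longleftrightarrow> (\<forall>a. sat I p (e(x := a)))"

record ('s, 'n) extension =
  std :: "'s \<Rightarrow> 'n"
  ext :: "'s list set \<Rightarrow> 'n list set"

definition nonstandard_extension :: "('s, 'n) extension \<Rightarrow> bool" where
  "nonstandard_extension S \<longleftrightarrow>
     (\<forall>p e. sat (\<lambda>R. R) p e \<longleftrightarrow> sat (ext S) p (std S \<circ> e))"

definition star_set :: "('s, 'n) extension \<Rightarrow> 's set \<Rightarrow> 'n set" where
  "star_set S A = {x. [x] \<in> ext S ((\<lambda>a. [a]) ` A)}"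

text \<open>The value at \<open>xs\<close> of \<open>*F\<close>, where the standard (partial) function \<open>F\<close> is given by its graph
  \<open>G\<close>, the value being the last entry of each list.\<close>

definition star_app :: "('s, 'n) extension \<Rightarrow> 's list set \<Rightarrow> 'n list \<Rightarrow> 'n" where
  "star_app S G xs = (THE y. xs @ [y] \<in> ext S G)"

text \<open>Internal sets are the sections of the relations \<open>*R\<close> at internal parameters. By the internal
  definition principle these are the elements of the sets \<open>*(Pow A)\<close>; the description by
  parameters does not need the power sets to be objects of the universe.\<close>

definition internal_set :: "('s, 'n) extension \<Rightarrow> 'n set \<Rightarrow> bool" where
  "internal_set S A \<longleftrightarrow> (\<exists>R ps. A = {x. x # ps \<in> ext S R})"

text \<open>\<open>\<kappa>\<close>-saturation concerns families of fewer than \<open>\<kappa>\<close> internal sets; the cardinal \<open>\<kappa>\<close> is given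
  as the cardinality of a set \<open>K\<close>.\<close>

definition saturated :: "('s, 'n) extension \<Rightarrow> 'c set \<Rightarrow> bool" where
  "saturated S K \<longleftrightarrow>
     (\<forall>\<A>. (\<forall>A\<in>\<A>. internal_set S A) \<and> (card_of \<A>, card_of K) \<in> ordLess \<and>
          (\<forall>\<F>. \<F> \<subseteq> \<A> \<and> finite \<F> \<longrightarrow> \<Inter>\<F> \<noteq> {}) \<longrightarrow> \<Inter>\<A> \<noteq> {})"


section \<open>The universe over the reals and its hyperreals\<close>

text \<open>The levels of the superstructure that matter here: real numbers, points, real functions of a
  point, and sets of points.\<close>

datatype 'k obj =
    Num real
  | Pt "real ^ 'k"
  | Fun "real ^ 'k \<Rightarrow> real"
  | PtSet "(real ^ 'k) set"

type_synonym ('k, 'n) real_extension = "('k obj, 'n) extension"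

definition hyperreals :: "('k::finite, 'n) real_extension \<Rightarrow> 'n set" where
  "hyperreals S = star_set S (range Num)"

definition hypernats :: "('k::finite, 'n) real_extension \<Rightarrow> 'n set" where
  "hypernats S = star_set S (Num ` \<nat>)"

definition hyperints :: "('k::finite, 'n) real_extension \<Rightarrow> 'n set" where
  "hyperints S = star_set S (Num ` \<int>)"

definition hless :: "('k::finite, 'n) real_extension \<Rightarrow> 'n \<Rightarrow> 'n \<Rightarrow> bool" where
  "hless S x y \<longleftrightarrow> [x, y] \<in> ext S {[Num a, Num b] | a b. a < b}"

definition hle :: "('k::finite, 'n) real_extension \<Rightarrow> 'n \<Rightarrow> 'n \<Rightarrow> bool" where
  "hle S x y \<longleftrightarrow> [x, y] \<in> ext S {[Num a, Num b] | a b. a \<le> b}"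

definition hminus :: "('k::finite, 'n) real_extension \<Rightarrow> 'n \<Rightarrow> 'n \<Rightarrow> 'n" where
  "hminus S x y = star_app S {[Num a, Num b, Num (a - b)] | a b. True} [x, y]"

definition htimes :: "('k::finite, 'n) real_extension \<Rightarrow> 'n \<Rightarrow> 'n \<Rightarrow> 'n" where
  "htimes S x y = star_app S {[Num a, Num b, Num (a * b)] | a b. True} [x, y]"

text \<open>\<open>*g(x)\<close> for \<open>g\<close> a function of a real variable.\<close>

definition hfun :: "('k::finite, 'n) real_extension \<Rightarrow> (real \<Rightarrow> real) \<Rightarrow> 'n \<Rightarrow> 'n" where
  "hfun S g x = star_app S {[Num a, Num (g a)] | a. True} [x]"

text \<open>\<open>*\<phi>(x)\<close> for \<open>\<phi>\<close> a real function of a point.\<close>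

definition hfun_pt :: "('k::finite, 'n) real_extension \<Rightarrow> (real ^ 'k \<Rightarrow> real) \<Rightarrow> 'n \<Rightarrow> 'n" where
  "hfun_pt S \<phi> x = star_app S {[Pt p, Num (\<phi> p)] | p. True} [x]"

definition hcoord :: "('k::finite, 'n) real_extension \<Rightarrow> 'k \<Rightarrow> 'n \<Rightarrow> 'n" where
  "hcoord S i x = hfun_pt S (\<lambda>p. p $ i) x"

definition hfact :: "('k::finite, 'n) real_extension \<Rightarrow> 'n \<Rightarrow> 'n" where
  "hfact S x = star_app S {[Num (real m), Num (fact m)] | m. True} [x]"

definition infinite_hypernat :: "('k::finite, 'n) real_extension \<Rightarrow> 'n \<Rightarrow> bool" where
  "infinite_hypernat S N \<longleftrightarrow> N \<in> hypernats S \<and> (\<forall>m::nat. hless S (std S (Num (real m))) N)"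

definition approx :: "('k::finite, 'n) real_extension \<Rightarrow> 'n \<Rightarrow> 'n \<Rightarrow> bool" where
  "approx S x y \<longleftrightarrow>
     (\<forall>r>0. hless S (std S (Num (- r))) (hminus S x y) \<and> hless S (hminus S x y) (std S (Num r)))"


section \<open>Grid functions\<close>

text \<open>In this section \<open>N0\<close> is the infinite hypernatural that determines \<open>N = N0!\<close> and
  \<open>\<epsilon> = 1 / N\<close>.\<close>

definition grid_N :: "('k::finite, 'n) real_extension \<Rightarrow> 'n \<Rightarrow> 'n" where
  "grid_N S N0 = hfact S N0"

definition grid_eps :: "('k::finite, 'n) real_extension \<Rightarrow> 'n \<Rightarrow> 'n" where
  "grid_eps S N0 = hfun S (\<lambda>a. 1 / a) (grid_N S N0)"

definition grid1 :: "('k::finite, 'n) real_extension \<Rightarrow> 'n \<Rightarrow> 'n set" where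
  "grid1 S N0 =
     {htimes S m (grid_eps S N0) | m.
        m \<in> hyperints S \<and> hle S (hfun S (\<lambda>a. - (a ^ 2)) (grid_N S N0)) m \<and>
        hle S m (hfun S (\<lambda>a. a ^ 2) (grid_N S N0))}"

definition grid :: "('k::finite, 'n) real_extension \<Rightarrow> 'n \<Rightarrow> (real ^ 'k) set \<Rightarrow> 'n set" where
  "grid S N0 \<Omega> = {x \<in> star_set S (Pt ` \<Omega>). \<forall>i. hcoord S i x \<in> grid1 S N0}"

text \<open>\<open>represents S c A f\<close>: the function \<open>f\<close> on \<open>A\<close> is the restriction of \<open>c\<close>, an element of
  \<open>*(\<real>^k \<rightarrow> \<real>)\<close>. An internal function on an internal set of points extends to all of
  \<open>*\<real>^k\<close> by zero, so the internal functions on \<open>A\<close> are those represented by some \<open>c\<close>.\<close>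

definition represents :: "('k::finite, 'n) real_extension \<Rightarrow> 'n \<Rightarrow> 'n set \<Rightarrow> ('n \<Rightarrow> 'n) \<Rightarrow> bool" where
  "represents S c A f \<longleftrightarrow> c \<in> star_set S (range Fun) \<and>
     (\<forall>x\<in>A. f x = star_app S {[Fun h, Pt p, Num (h p)] | h p. True} [c, x])"

definition internal_fun_on :: "('k::finite, 'n) real_extension \<Rightarrow> 'n set \<Rightarrow> ('n \<Rightarrow> 'n) \<Rightarrow> bool" where
  "internal_fun_on S A f \<longleftrightarrow> (\<exists>c. represents S c A f)"

definition grid_functions ::
    "('k::finite, 'n) real_extension \<Rightarrow> 'n \<Rightarrow> (real ^ 'k) set \<Rightarrow> ('n \<Rightarrow> 'n) set" where
  "grid_functions S N0 \<Omega> =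
     {f \<in> grid S N0 \<Omega> \<rightarrow>\<^sub>E hyperreals S. internal_fun_on S (grid S N0 \<Omega>) f}"

text \<open>The sum of an internal function over a hyperfinite set \<open>A\<close>, i.e. the extension of the
  operation \<open>(A, f) \<mapsto> (\<Sum>x\<in>A. f x)\<close> on finite sets. Here \<open>a\<close> is \<open>A\<close> as an element of the
  extension of the collection of finite sets of points.\<close>

definition hyper_sum :: "('k::finite, 'n) real_extension \<Rightarrow> 'n set \<Rightarrow> ('n \<Rightarrow> 'n) \<Rightarrow> 'n" where
  "hyper_sum S A f =
     (THE s. \<exists>a c. a \<in> star_set S {PtSet F | F. finite F} \<and>
        {x. [x, a] \<in> ext S {[Pt p, PtSet F] | p F. p \<in> F}} = A \<and>
        represents S c A f \<and>
        s = star_app S {[PtSet F, Fun h, Num (\<Sum>p\<in>F. h p)] | F h. finite F} [a, c])"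

definition grid_inner ::
    "('k::finite, 'n) real_extension \<Rightarrow> 'n \<Rightarrow> (real ^ 'k) set \<Rightarrow> ('n \<Rightarrow> 'n) \<Rightarrow> ('n \<Rightarrow> 'n) \<Rightarrow> 'n" where
  "grid_inner S N0 \<Omega> f h =
     htimes S (hfun S (\<lambda>a. a ^ CARD('k)) (grid_eps S N0))
       (hyper_sum S (grid S N0 \<Omega>) (\<lambda>x. htimes S (f x) (h x)))"


section \<open>Function spaces and distributions\<close>

text \<open>Functions with compact support in \<open>\<Omega>\<close> are extended by zero to the whole space.\<close>

definition compact_support_in :: "'a::topological_space set \<Rightarrow> ('a \<Rightarrow> real) \<Rightarrow> bool" where
  "compact_support_in \<Omega> \<phi> \<longleftrightarrow>
     compact (closure {x. \<phi> x \<noteq> 0}) \<and> closure {x. \<phi> x \<noteq> 0} \<subseteq> \<Omega>"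

definition C0c :: "'a::topological_space set \<Rightarrow> ('a \<Rightarrow> real) set" where
  "C0c \<Omega> = {\<phi>. continuous_on UNIV \<phi> \<and> compact_support_in \<Omega> \<phi>}"

definition C0b :: "(real \<Rightarrow> real) set" where
  "C0b = {g. continuous_on UNIV g \<and> bounded (range g) \<and> (g \<longlongrightarrow> 0) at_infinity}"

definition sup_norm :: "('a \<Rightarrow> real) \<Rightarrow> real" where
  "sup_norm \<phi> = (SUP x. \<bar>\<phi> x\<bar>)"

definition linear_functional_on :: "('a \<Rightarrow> real) set \<Rightarrow> (('a \<Rightarrow> real) \<Rightarrow> real) \<Rightarrow> bool" where
  "linear_functional_on V T \<longleftrightarrow>
     (\<forall>\<phi>\<in>V. \<forall>\<psi>\<in>V. \<forall>a b. T (\<lambda>x. a * \<phi> x + b * \<psi> x) = a * T \<phi> + b * T \<psi>)"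

text \<open>Only the values on \<open>C0c \<Omega>\<close> are relevant.\<close>

definition C0c_dual :: "'a::topological_space set \<Rightarrow> (('a \<Rightarrow> real) \<Rightarrow> real) set" where
  "C0c_dual \<Omega> =
     {T. linear_functional_on (C0c \<Omega>) T \<and> (\<exists>C. \<forall>\<phi>\<in>C0c \<Omega>. \<bar>T \<phi>\<bar> \<le> C * sup_norm \<phi>)}"

definition partial_deriv :: "'k::finite \<Rightarrow> (real ^ 'k \<Rightarrow> real) \<Rightarrow> real ^ 'k \<Rightarrow> real" where
  "partial_deriv i f x = deriv (\<lambda>t. f (x + t *\<^sub>R axis i 1)) 0"

definition iterated_partial :: "'k::finite list \<Rightarrow> (real ^ 'k \<Rightarrow> real) \<Rightarrow> real ^ 'k \<Rightarrow> real" where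
  "iterated_partial is f = foldr partial_deriv is f"

definition smooth :: "(real ^ 'k::finite \<Rightarrow> real) \<Rightarrow> bool" where
  "smooth f \<longleftrightarrow>
     (\<forall>is. continuous_on UNIV (iterated_partial is f) \<and>
       (\<forall>i x. (\<lambda>t. iterated_partial is f (x + t *\<^sub>R axis i 1)) field_differentiable (at 0)))"

definition test_functions :: "(real ^ 'k::finite) set \<Rightarrow> (real ^ 'k \<Rightarrow> real) set" where
  "test_functions \<Omega> = {\<phi>. smooth \<phi> \<and> compact_support_in \<Omega> \<phi>}"

text \<open>Continuity is expressed by the seminorm estimates on each compact \<open>K \<subseteq> \<Omega>\<close>. The
  functionals are made extensional because the cardinality of this set is used: two of
  them must not differ merely outside the test functions.\<close>

definition distributions :: "(real ^ 'k::finite) set \<Rightarrow> ((real ^ 'k \<Rightarrow> real) \<Rightarrow> real) set" where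
  "distributions \<Omega> =
     {T \<in> extensional (test_functions \<Omega>).
        linear_functional_on (test_functions \<Omega>) T \<and>
        (\<forall>K. compact K \<and> K \<subseteq> \<Omega> \<longrightarrow>
          (\<exists>C m. \<forall>\<phi>\<in>test_functions \<Omega>. closure {x. \<phi> x \<noteq> 0} \<subseteq> K \<longrightarrow>
             \<bar>T \<phi>\<bar> \<le> C * (\<Sum>is\<in>{is. length is \<le> m}. sup_norm (iterated_partial is \<phi>))))}"


section \<open>Convergence in the space of functionals and Young measures\<close>

definition bounded_L1_sequence ::
    "'a::euclidean_space set \<Rightarrow> (nat \<Rightarrow> 'a \<Rightarrow> real) \<Rightarrow> bool" where
  "bounded_L1_sequence \<Omega> z \<longleftrightarrow>
     (\<forall>n. set_integrable lebesgue \<Omega> (z n)) \<and>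
     (\<exists>C. \<forall>n. (LINT x:\<Omega>|lebesgue. \<bar>z n x\<bar>) \<le> C)"

definition weak_star_converges ::
    "'a::euclidean_space set \<Rightarrow> (nat \<Rightarrow> 'a \<Rightarrow> real) \<Rightarrow> (('a \<Rightarrow> real) \<Rightarrow> real) \<Rightarrow> bool" where
  "weak_star_converges \<Omega> z T \<longleftrightarrow> T \<in> C0c_dual \<Omega> \<and>
     (\<forall>\<phi>\<in>C0c \<Omega>. (\<lambda>n. LINT x:\<Omega>|lebesgue. z n x * \<phi> x) \<longlonglongrightarrow> T \<phi>)"

definition radon_probability_measures :: "real measure set" where
  "radon_probability_measures =
     {M. sets M = sets borel \<and> prob_space M \<and>
         (\<forall>A\<in>sets M. emeasure M A = (SUP K\<in>{K. K \<subseteq> A \<and> compact K}. emeasure M K))}"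

definition young_measure :: "'a::euclidean_space set \<Rightarrow> ('a \<Rightarrow> real measure) \<Rightarrow> bool" where
  "young_measure \<Omega> \<nu> \<longleftrightarrow>
     (\<forall>x\<in>\<Omega>. \<nu> x \<in> radon_probability_measures) \<and>
     (\<forall>g\<in>C0b. (\<lambda>x. \<integral>y. g y \<partial>\<nu> x) \<in> borel_measurable (lebesgue_on \<Omega>))"

definition young_converges ::
    "'a::euclidean_space set \<Rightarrow> (nat \<Rightarrow> 'a \<Rightarrow> real) \<Rightarrow> ('a \<Rightarrow> real measure) \<Rightarrow> bool" where
  "young_converges \<Omega> z \<nu> \<longleftrightarrow>
     (\<forall>g\<in>C0b. \<forall>\<phi>\<in>C0c \<Omega>.
        (\<lambda>n. LINT x:\<Omega>|lebesgue. g (z n x) * \<phi> x) \<longlonglongrightarrow>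
        (LINT x:\<Omega>|lebesgue. (\<integral>y. g y \<partial>\<nu> x) * \<phi> x))"

end

theory Submission
  imports Defs
begin

text \<open>
  A single standard sequence of samples serves all \<open>\<phi>\<close> and \<open>g\<close> at once. Extend \<open>z\<^sub>n\<close> by zero and
  approximate it in \<open>L\<^sup>1\<close> up to \<open>1 / (n + 1)\<close> by a continuous function \<open>w\<^sub>n\<close>. On the standard grid of
  mesh \<open>1 / m!\<close> sample \<open>w\<^sub>n\<close> with \<open>n = n(m)\<close> growing so slowly that \<open>w\<^sub>n\<close> oscillates by at most
  \<open>1 / (n + 1)\<close> over the cells in the ball of radius \<open>n\<close>. The Riemann sum of \<open>\<gamma>(w\<^sub>n) \<phi>\<close> then differs
  from \<open>\<integral> \<gamma>(z\<^sub>n) \<phi>\<close> by a null sequence, for \<open>\<gamma>\<close> the identity or in \<open>C\<^sub>b\<^sup>0\<close>: the oscillation of \<open>\<gamma>(w\<^sub>n)\<close>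
  is small on the support of \<open>\<phi>\<close>, and that of \<open>\<phi>\<close> is multiplied by \<open>\<gamma>(w\<^sub>n)\<close>, which is bounded in
  \<open>L\<^sup>1\<close> there. The grid function is the value at \<open>N0\<close> of the extended sequence of samples.
  Adding \<open>1 / (m + 1)\<close> to the samples changes the grid function but none of the limits.
\<close>

section \<open>Sampling on standard grids\<close>

text \<open>The counterpart of \<open>grid1\<close> with \<open>N = m!\<close>. Through
  \<open>grid_iff\<close>, the hyperfinite grid is the value of these standard grids at the index
  \<open>N0\<close>.\<close>

definition grid_coords :: "nat \<Rightarrow> real set" where
  "grid_coords m = {of_int j / fact m | j. - ((fact m)\<^sup>2) \<le> j \<and> j \<le> (fact m)\<^sup>2}"

definition grid_points :: "(real ^ 'k) set \<Rightarrow> nat \<Rightarrow> (real ^ 'k) set" where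
  "grid_points \<Omega> m = {p \<in> \<Omega>. \<forall>i. p $ i \<in> grid_coords m}"

lemma finite_grid_points: "finite (grid_points \<Omega> m)"
proof -
  have "grid_coords m = (\<lambda>j. of_int j / fact m) ` {- ((fact m)\<^sup>2)..(fact m)\<^sup>2}"
    by (auto simp: grid_coords_def)
  then have fin: "finite (grid_coords m)" by simp
  have "grid_points \<Omega> m \<subseteq> (\<lambda>f. \<chi> i. f i) ` (UNIV \<rightarrow>\<^sub>E grid_coords m)"
  proof
    fix p assume "p \<in> grid_points \<Omega> m"
    then have "p = (\<chi> i. ($) p i)" "($) p \<in> UNIV \<rightarrow>\<^sub>E grid_coords m"
      by (auto simp: grid_points_def)
    then show "p \<in> (\<lambda>f. \<chi> i. f i) ` (UNIV \<rightarrow>\<^sub>E grid_coords m)" by blast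
  qed
  moreover have "finite (UNIV \<rightarrow>\<^sub>E grid_coords m :: ('a \<Rightarrow> real) set)"
    using fin by (intro finite_PiE) auto
  ultimately show ?thesis using finite_subset by blast
qed

section \<open>Rounding to the standard grid and Riemann sums\<close>

definition snap :: "nat \<Rightarrow> real ^ 'k \<Rightarrow> real ^ 'k" where
  "snap m y = (\<chi> i. of_int \<lfloor>y $ i * fact m\<rfloor> / fact m)"

lemma norm_snap_diff_le:
  fixes y :: "real ^ 'k::finite"
  shows "norm (snap m y - y) \<le> CARD('k) / fact m"
proof -
  have "\<bar>(snap m y - y) $ i\<bar> \<le> 1 / fact m" for i
  proof -
    have "(snap m y - y) $ i = (of_int \<lfloor>y $ i * fact m\<rfloor> - y $ i * fact m) / fact m"
      by (simp add: snap_def field_simps)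
    moreover have "\<bar>of_int \<lfloor>y $ i * fact m\<rfloor> - y $ i * fact m\<bar> \<le> 1" by linarith
    ultimately show ?thesis by (simp add: divide_right_mono)
  qed
  then have "norm (snap m y - y) \<le> (\<Sum>i\<in>(UNIV::'k set). 1 / fact m)"
    by (intro order_trans[OF norm_le_l1_cart] sum_mono)
  then show ?thesis by simp
qed

text \<open>A bound independent of \<open>m\<close>: snapping keeps a ball inside a fixed larger
  ball.\<close>

lemma norm_snap_diff_le_card:
  fixes y :: "real ^ 'k::finite"
  shows "norm (snap m y - y) \<le> CARD('k)"
proof -
  have "CARD('k) / fact m \<le> CARD('k) / (1::real)"
    by (intro divide_left_mono) (auto simp: fact_ge_1)
  then show ?thesis using norm_snap_diff_le[of m y] by simp
qed

lemma filterlim_fact_real: "filterlim (\<lambda>m. fact m :: real) at_top sequentially"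
proof (rule filterlim_at_top_mono[OF filterlim_real_sequentially])
  have "real m \<le> fact m" for m
    using fact_ge_self[of m] by (metis of_nat_fact of_nat_le_iff)
  then show "\<forall>\<^sub>F m in sequentially. real m \<le> fact m" by simp
qed

text \<open>Both \<open>y\<close> and \<open>snap m y\<close> lie in the ball of radius
  \<open>B + CARD('k)\<close>, on which \<open>f\<close> is uniformly continuous, and their distance
  tends to 0 uniformly in \<open>y\<close>.\<close>

lemma snap_uniform:
  fixes f :: "real ^ 'k::finite \<Rightarrow> real"
  assumes f: "continuous_on UNIV f" and e: "0 < e"
  shows "\<forall>\<^sub>F m in sequentially. \<forall>y\<in>cball 0 B. \<bar>f (snap m y) - f y\<bar> \<le> e"
proof -
  have "uniformly_continuous_on (cball 0 (B + CARD('k))) f"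
    using f by (intro compact_uniformly_continuous) (auto intro: continuous_on_subset)
  then obtain d where d: "0 < d" and
    uc: "\<And>x x'. x \<in> cball 0 (B + CARD('k)) \<Longrightarrow> x' \<in> cball 0 (B + CARD('k)) \<Longrightarrow>
      dist x' x < d \<Longrightarrow> dist (f x') (f x) < e"
    using e unfolding uniformly_continuous_on_def by metis
  have "(\<lambda>m. CARD('k) / (fact m :: real)) \<longlonglongrightarrow> 0"
    by (rule tendsto_divide_0[OF tendsto_const])
       (rule filterlim_at_top_imp_at_infinity[OF filterlim_fact_real])
  then have "\<forall>\<^sub>F m in sequentially. CARD('k) / (fact m :: real) < d"
    using d order_tendstoD(2) by blast
  then show ?thesis
  proof eventually_elim
    case (elim m)
    show ?case
    proof
      fix y :: "real ^ 'k" assume y: "y \<in> cball 0 B"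
      have "norm (snap m y) \<le> norm y + CARD('k)"
        using norm_snap_diff_le_card[of m y] norm_triangle_sub[of "snap m y" y] by linarith
      moreover have "dist (snap m y) y < d"
        using elim norm_snap_diff_le[of m y] by (simp add: dist_norm)
      ultimately have "dist (f (snap m y)) (f y) < e"
        using y by (intro uc) auto
      then show "\<bar>f (snap m y) - f y\<bar> \<le> e" by (simp add: dist_real_def)
    qed
  qed
qed

text \<open>The fibre is a half-open cube with lower corner \<open>x\<close> and side
  \<open>1 / fact m\<close>; it differs from the closed box only by part of the frontier, a null
  set.\<close>

lemma snap_cell:
  fixes x :: "real ^ 'k::finite"
  assumes x: "\<And>i. x $ i * fact m \<in> \<int>"
  shows "{y. snap m y = x} \<in> lmeasurable"
    and "measure lebesgue {y. snap m y = x} = (1 / fact m) ^ CARD('k)"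
proof -
  define b where "b = x + (\<chi> i. 1 / fact m)"
  have iff: "snap m y = x \<longleftrightarrow> (\<forall>i. x $ i \<le> y $ i \<and> y $ i < b $ i)" for y
  proof -
    have "of_int \<lfloor>y $ i * fact m\<rfloor> / fact m = x $ i \<longleftrightarrow> x $ i \<le> y $ i \<and> y $ i < b $ i" for i
    proof -
      obtain j where j: "x $ i * fact m = of_int j" using x[of i] by (auto elim: Ints_cases)
      then have xj: "x $ i = of_int j / fact m" by (simp add: field_simps)
      have "of_int \<lfloor>y $ i * fact m\<rfloor> / fact m = x $ i \<longleftrightarrow> \<lfloor>y $ i * fact m\<rfloor> = j"
        by (simp add: xj)
      also have "\<dots> \<longleftrightarrow> of_int j \<le> y $ i * fact m \<and> y $ i * fact m < of_int j + 1"
        by linarith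
      also have "\<dots> \<longleftrightarrow> x $ i \<le> y $ i \<and> y $ i < b $ i"
        by (simp add: xj b_def field_simps)
      finally show ?thesis .
    qed
    then show ?thesis by (simp add: snap_def vec_eq_iff)
  qed
  have neg: "negligible ((cbox x b - {y. snap m y = x}) \<union> ({y. snap m y = x} - cbox x b))"
    by (rule negligible_subset[OF negligible_frontier_interval[of x b]])
       (auto simp: iff mem_box_cart less_imp_le intro: order_less_imp_le)
  show "{y. snap m y = x} \<in> lmeasurable"
    using lmeasurable_negligible_symdiff[OF lmeasurable_cbox neg] .
  have "measure lebesgue {y. snap m y = x} = measure lebesgue (cbox x b)"
    using measure_negligible_symdiff[OF _ neg] by simp
  also have "\<dots> = (\<Prod>i\<in>UNIV. b $ i - x $ i)"
  proof -
    have "x \<in> cbox x b" by (simp add: mem_box_cart b_def)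
    then show ?thesis using content_cbox_cart[of x b] by auto
  qed
  also have "\<dots> = (1 / fact m) ^ CARD('k)" by (simp add: b_def)
  finally show "measure lebesgue {y. snap m y = x} = (1 / fact m) ^ CARD('k)" .
qed

text \<open>A norm below \<open>fact m\<close> keeps every numerator below \<open>(fact m)^2\<close>
  in absolute value, which is the cut-off in \<open>grid_coords\<close>.\<close>

lemma snap_in_grid_points:
  fixes y :: "real ^ 'k::finite"
  assumes "snap m y \<in> \<Omega>" "norm (snap m y) < fact m"
  shows "snap m y \<in> grid_points \<Omega> m"
proof -
  have "snap m y $ i \<in> grid_coords m" for i
  proof -
    define j where "j = \<lfloor>y $ i * fact m\<rfloor>"
    have s: "snap m y $ i = of_int j / fact m" by (simp add: snap_def j_def)
    have "\<bar>snap m y $ i\<bar> < fact m"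
      using assms(2) component_le_norm_cart[of "snap m y" i] by linarith
    then have "\<bar>real_of_int j\<bar> < fact m * fact m" by (simp add: s field_simps)
    then have "\<bar>real_of_int j\<bar> < of_int (fact m * fact m)" by simp
    then have "\<bar>j\<bar> < fact m * fact m" by linarith
    then have "- ((fact m)\<^sup>2) \<le> j \<and> j \<le> (fact m)\<^sup>2" unfolding power2_eq_square by linarith
    with s show ?thesis by (auto simp: grid_coords_def)
  qed
  with assms(1) show ?thesis by (simp add: grid_points_def)
qed

text \<open>The function \<open>F \<circ> snap m\<close> is constant on each cell, and all cells
  have volume \<open>(1 / fact m) ^ CARD('k)\<close>. The hypothesis puts every cell on which it is
  nonzero among those of \<open>grid_points \<Omega> m\<close>, so the Riemann sum is exactly an
  integral.\<close>

lemma riemann_sum: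
  fixes F :: "real ^ 'k::finite \<Rightarrow> real"
  assumes F: "\<And>x. F x \<noteq> 0 \<Longrightarrow> x \<in> \<Omega> \<and> norm x < fact m"
  shows "has_bochner_integral lebesgue (\<lambda>y. F (snap m y))
    ((1 / fact m) ^ CARD('k) * (\<Sum>x\<in>grid_points \<Omega> m. F x))"
proof -
  have int: "x $ i * fact m \<in> \<int>" if "x \<in> grid_points \<Omega> m" for x and i :: 'k
    using that by (auto simp: grid_points_def grid_coords_def) (metis Ints_of_int fact_nonzero nonzero_eq_divide_eq)
  have mem: "snap m y \<in> grid_points \<Omega> m" if "F (snap m y) \<noteq> 0" for y
    using F[OF that] by (intro snap_in_grid_points) auto
  have "(\<lambda>y. F (snap m y)) = (\<lambda>y. \<Sum>x\<in>grid_points \<Omega> m. F x * indicator {y. snap m y = x} y)"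
  proof
    fix y
    have "(\<Sum>x\<in>grid_points \<Omega> m. F x * indicator {y. snap m y = x} y) =
        (\<Sum>x\<in>grid_points \<Omega> m. if snap m y = x then F x else 0)"
      by (intro sum.cong) (auto simp: indicator_def)
    also have "\<dots> = F (snap m y)"
      using mem[of y] by (auto simp: sum.delta' finite_grid_points)
    finally show "F (snap m y) = (\<Sum>x\<in>grid_points \<Omega> m. F x * indicator {y. snap m y = x} y)" ..
  qed
  moreover have "has_bochner_integral lebesgue
      (\<lambda>y. \<Sum>x\<in>grid_points \<Omega> m. F x * indicator {y. snap m y = x} y)
      (\<Sum>x\<in>grid_points \<Omega> m. F x * (1 / fact m) ^ CARD('k))"
  proof (intro has_bochner_integral_sum has_bochner_integral_mult_right)
    fix x assume "x \<in> grid_points \<Omega> m"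
    note cell = snap_cell[OF int[OF this]]
    show "has_bochner_integral lebesgue (indicator {y. snap m y = x}) ((1 / fact m) ^ CARD('k) :: real)"
      unfolding cell(2)[symmetric]
      by (rule has_bochner_integral_real_indicator) (use cell(1) in \<open>auto simp: fmeasurable_def\<close>)
  qed
  moreover have "(\<Sum>x\<in>grid_points \<Omega> m. F x * (1 / fact m) ^ CARD('k)) =
      (1 / fact m) ^ CARD('k) * (\<Sum>x\<in>grid_points \<Omega> m. F x)"
    by (simp add: sum_distrib_right[symmetric] mult.commute)
  ultimately show ?thesis by (simp only:)
qed

section \<open>Approximation of integrable functions by continuous ones\<close>

lemma continuous_imp_lebesgue_measurable:
  fixes f :: "'a::euclidean_space \<Rightarrow> real"
  assumes "continuous_on UNIV f"
  shows "f \<in> borel_measurable lebesgue"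
  using borel_measurable_continuous_onI[OF assms] by (intro measurable_completion) simp

text \<open>Clamping between \<open>- b j\<close> and \<open>b j\<close> first replaces
  \<open>f\<close> by a function with an integrable envelope. Continuous functions converging to
  \<open>f\<close> almost everywhere, clamped in the same way, then converge in mean by dominated
  convergence.\<close>

lemma L1_approx_continuous:
  fixes f :: "'a::euclidean_space \<Rightarrow> real"
  assumes f: "integrable lebesgue f" and e: "0 < e"
  obtains w where "continuous_on UNIV w" "integrable lebesgue w" "(\<integral>y. \<bar>w y - f y\<bar> \<partial>lebesgue) < e"
proof -
  \<comment> \<open>The envelope \<open>b j\<close> is continuous, vanishes outside the ball of
    radius \<open>j\<close>, and is at least \<open>j\<close> at \<open>y\<close> once
    \<open>j \<ge> norm y + 1\<close>. So it is integrable, and clamping by it eventually leaves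
    each value of \<open>f\<close> unchanged.\<close>
  define b where "b = (\<lambda>(j::nat) (y::'a). real j * max 0 (real j - norm y))"
  define c where "c = (\<lambda>j u (y::'a). max (- b j y) (min (b j y) (u y)))"
  have b0: "0 \<le> b j y" for j y by (simp add: b_def)
  have contb: "continuous_on UNIV (b j)" for j
    unfolding b_def by (intro continuous_intros)
  have intb: "integrable lebesgue (b j)" for j
  proof -
    have "integrable lborel (\<lambda>y. indicator (cball 0 (real j)) y *\<^sub>R b j y)"
      by (rule borel_integrable_compact) (auto intro: continuous_on_subset[OF contb])
    also have "(\<lambda>y. indicator (cball 0 (real j)) y *\<^sub>R b j y) = b j"
    proof
      fix y
      show "indicator (cball 0 (real j)) y *\<^sub>R b j y = b j y"
        by (cases "norm y \<le> real j") (auto simp: b_def)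
    qed
    finally show ?thesis
      using borel_measurable_continuous_onI[OF contb] by (simp add: integrable_completion)
  qed
  have [measurable]: "f \<in> borel_measurable lebesgue" "b j \<in> borel_measurable lebesgue" for j
    using borel_measurable_integrable[OF f] borel_measurable_integrable[OF intb] by auto
  have cm [measurable]: "c j u \<in> borel_measurable lebesgue" if "u \<in> borel_measurable lebesgue" for j u
    using that unfolding c_def by measurable
  have "(\<lambda>j. \<integral>y. \<bar>c j f y - f y\<bar> \<partial>lebesgue) \<longlonglongrightarrow> (\<integral>y. 0 \<partial>(lebesgue :: 'a measure))"
  proof (rule integral_dominated_convergence[where w = "\<lambda>y. \<bar>f y\<bar>"])
    show "integrable lebesgue (\<lambda>y. \<bar>f y\<bar>)" using f by simp
    show "AE y in lebesgue. (\<lambda>j. \<bar>c j f y - f y\<bar>) \<longlonglongrightarrow> 0"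
    proof (rule AE_I2, rule tendsto_eventually)
      fix y
      obtain j0 :: nat where j0: "norm y + 1 + \<bar>f y\<bar> \<le> real j0" using real_arch_simple by blast
      show "\<forall>\<^sub>F j in sequentially. \<bar>c j f y - f y\<bar> = 0"
        using eventually_ge_at_top[of j0]
      proof eventually_elim
        case (elim j)
        then have j: "norm y + 1 + \<bar>f y\<bar> \<le> real j" using j0 by linarith
        have "real j * 1 \<le> b j y" unfolding b_def using j by (intro mult_left_mono) auto
        then have "\<bar>f y\<bar> \<le> b j y" using j norm_ge_zero[of y] by linarith
        then show ?case by (auto simp: c_def)
      qed
    qed
    \<comment> \<open>The clamping interval contains 0, so the truncation error never exceeds
      \<open>\<bar>f y\<bar>\<close>.\<close>
    show "AE y in lebesgue. norm \<bar>c j f y - f y\<bar> \<le> \<bar>f y\<bar>" for j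
      using b0[of j] by (intro AE_I2) (auto simp: c_def max_def min_def abs_if)
  qed measurable
  then have "\<forall>\<^sub>F j in sequentially. (\<integral>y. \<bar>c j f y - f y\<bar> \<partial>lebesgue) < e / 2"
    using e by (intro order_tendstoD(2)) auto
  then obtain j where j: "(\<integral>y. \<bar>c j f y - f y\<bar> \<partial>lebesgue) < e / 2"
    using eventually_happens trivial_limit_sequentially by blast
  \<comment> \<open>Measurability supplies continuous \<open>g n\<close> tending to \<open>f\<close>
    off a null set, but without an integrable bound; clamping provides one.\<close>
  have "f measurable_on UNIV" by (rule lebesgue_measurable_imp_measurable_on_real) auto
  then obtain N g where N: "negligible N" and contg: "\<And>n. continuous_on UNIV (g n)"
    and lim: "\<And>x. x \<notin> N \<Longrightarrow> (\<lambda>n. g n x) \<longlonglongrightarrow> f x"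
    unfolding measurable_on_def by auto
  have contc: "continuous_on UNIV (c j (g n))" for n
    unfolding c_def by (intro continuous_intros contb contg)
  have cmg [measurable]: "c j (g n) \<in> borel_measurable lebesgue" for n
    by (rule continuous_imp_lebesgue_measurable[OF contc])
  have cb: "\<bar>c j u y\<bar> \<le> b j y" for u y using b0[of j y] by (auto simp: c_def)
  have intc: "integrable lebesgue (c j (g n))" for n
    by (rule Bochner_Integration.integrable_bound[OF intb[of j] cmg]) (auto simp: cb b0)
  have intcf: "integrable lebesgue (c j f)"
    by (rule Bochner_Integration.integrable_bound[OF intb[of j]]) (auto simp: cb b0)
  have "(\<lambda>n. \<integral>y. \<bar>c j (g n) y - c j f y\<bar> \<partial>lebesgue) \<longlonglongrightarrow> (\<integral>y. 0 \<partial>(lebesgue :: 'a measure))"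
  proof (rule integral_dominated_convergence[where w = "\<lambda>y. 2 * b j y"])
    show "integrable lebesgue (\<lambda>y. 2 * b j y)" using intb by simp
    have "AE y in lebesgue. y \<notin> N"
      using N by (simp add: negligible_iff_null_sets AE_not_in)
    then show "AE y in lebesgue. (\<lambda>n. \<bar>c j (g n) y - c j f y\<bar>) \<longlonglongrightarrow> 0"
    proof eventually_elim
      case (elim y)
      have "(\<lambda>n. c j (g n) y) \<longlonglongrightarrow> c j f y"
        unfolding c_def by (intro tendsto_intros lim elim)
      then show ?case using tendsto_rabs_zero LIM_zero by blast
    qed
    show "AE y in lebesgue. norm \<bar>c j (g n) y - c j f y\<bar> \<le> 2 * b j y" for n
    proof (rule AE_I2)
      fix y
      show "norm \<bar>c j (g n) y - c j f y\<bar> \<le> 2 * b j y"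
        using cb[of "g n" y] cb[of f y] by simp
    qed
  qed measurable
  then have "\<forall>\<^sub>F n in sequentially. (\<integral>y. \<bar>c j (g n) y - c j f y\<bar> \<partial>lebesgue) < e / 2"
    using e by (intro order_tendstoD(2)) auto
  then obtain n where n: "(\<integral>y. \<bar>c j (g n) y - c j f y\<bar> \<partial>lebesgue) < e / 2"
    using eventually_happens trivial_limit_sequentially by blast
  have "(\<integral>y. \<bar>c j (g n) y - f y\<bar> \<partial>lebesgue) \<le>
      (\<integral>y. \<bar>c j (g n) y - c j f y\<bar> + \<bar>c j f y - f y\<bar> \<partial>lebesgue)"
    using f intc[of n] intcf by (intro integral_mono) auto
  also have "\<dots> < e"
    using f intc[of n] intcf j n by (subst Bochner_Integration.integral_add) auto
  finally show thesis using that contc intc by blast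
qed

text \<open>Take for \<open>f m\<close> the largest \<open>n\<close> whose threshold
  \<open>M n\<close> has been passed at \<open>m\<close>; the restriction \<open>n \<le> m\<close>
  keeps the set of candidates finite, so that the maximum exists.\<close>

lemma diagonal_sequence:
  fixes P :: "nat \<Rightarrow> nat \<Rightarrow> bool"
  assumes "\<And>n. \<forall>\<^sub>F m in sequentially. P n m"
  obtains f where "filterlim f at_top sequentially" "\<forall>\<^sub>F m in sequentially. P (f m) m"
proof -
  obtain M where M: "\<And>n m. M n \<le> m \<Longrightarrow> P n m"
    using assms unfolding eventually_sequentially by metis
  define A where "A m = {n. n \<le> m \<and> M n \<le> m}" for m
  have fin: "finite (A m)" for m by (rule finite_subset[of _ "{..m}"]) (auto simp: A_def)
  define f where "f m = Max (A m)" for m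
  have "filterlim f at_top sequentially"
    unfolding filterlim_at_top
  proof
    fix n
    show "\<forall>\<^sub>F m in sequentially. n \<le> f m"
      using eventually_ge_at_top[of "max n (M n)"]
    proof eventually_elim
      case (elim m)
      then have "n \<in> A m" by (simp add: A_def)
      then show ?case unfolding f_def using fin by (intro Max_ge)
    qed
  qed
  moreover have "\<forall>\<^sub>F m in sequentially. P (f m) m"
    using eventually_ge_at_top[of "M 0"]
  proof eventually_elim
    case (elim m)
    \<comment> \<open>From the threshold \<open>M 0\<close> on, the index 0 is a candidate.\<close>
    then have "A m \<noteq> {}" by (auto simp: A_def)
    then have "f m \<in> A m" unfolding f_def using fin by (intro Max_in)
    then show ?case using M by (auto simp: A_def)
  qed
  ultimately show thesis using that by blast
qed

section \<open>Admissible nonlinearities\<close>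

text \<open>Equivalent to uniform continuity on the real line, in a form suited to integration: the
  term \<open>L * \<bar>s - t\<bar>\<close> is controlled by an \<open>L\<^sup>1\<close> distance,
  and the constant \<open>e\<close> by the volume of a ball.\<close>

definition almost_lipschitz :: "(real \<Rightarrow> real) \<Rightarrow> bool" where
  "almost_lipschitz \<gamma> \<longleftrightarrow> (\<forall>e>0. \<exists>L\<ge>0. \<forall>s t. \<bar>\<gamma> s - \<gamma> t\<bar> \<le> e + L * \<bar>s - t\<bar>)"

lemma almost_lipschitz_id: "almost_lipschitz (\<lambda>a. a)"
  unfolding almost_lipschitz_def by (auto intro!: exI[of _ 1])

text \<open>Close arguments are handled by uniform continuity on a compact interval or, further out,
  by the smallness of \<open>g\<close>. For distant ones the bound \<open>2 * C\<close> is absorbed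
  into the slope \<open>2 * C / \<delta>\<close>.\<close>

lemma C0b_almost_lipschitz:
  assumes g: "g \<in> C0b"
  shows "almost_lipschitz g"
  unfolding almost_lipschitz_def
proof (intro allI impI)
  fix e :: real assume e: "0 < e"
  have cont: "continuous_on UNIV g" and lim: "(g \<longlongrightarrow> 0) at_infinity"
    using g by (auto simp: C0b_def)
  obtain C where C: "\<And>s. \<bar>g s\<bar> \<le> C" using g by (auto simp: C0b_def bounded_iff)
  obtain K where K: "\<And>s. K \<le> \<bar>s\<bar> \<Longrightarrow> \<bar>g s\<bar> < e / 2"
    using tendstoD[OF lim, of "e / 2"] e by (auto simp: eventually_at_infinity)
  have "uniformly_continuous_on (cball 0 (K + 1)) g"
    using cont by (intro compact_uniformly_continuous) (auto intro: continuous_on_subset)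
  then obtain d where d: "0 < d" and
    uc: "\<And>s t. s \<in> cball 0 (K + 1) \<Longrightarrow> t \<in> cball 0 (K + 1) \<Longrightarrow> dist t s < d \<Longrightarrow> dist (g t) (g s) < e"
    using e unfolding uniformly_continuous_on_def by metis
  \<comment> \<open>As \<open>\<delta> \<le> 1\<close>, if one of two close arguments leaves the
    ball of radius \<open>K + 1\<close>, then both have absolute value at least
    \<open>K\<close>.\<close>
  define \<delta> where "\<delta> = min d 1"
  have \<delta>: "0 < \<delta>" using d by (simp add: \<delta>_def)
  have C0: "0 \<le> C" using C[of 0] by linarith
  have "\<bar>g s - g t\<bar> \<le> e + 2 * C / \<delta> * \<bar>s - t\<bar>" for s t
  proof (cases "\<bar>s - t\<bar> < \<delta>")
    case True
    have "\<bar>g s - g t\<bar> \<le> e"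
    proof (cases "\<bar>s\<bar> \<le> K + 1 \<and> \<bar>t\<bar> \<le> K + 1")
      case True
      with \<open>\<bar>s - t\<bar> < \<delta>\<close> have "dist (g s) (g t) < e"
        by (intro uc) (auto simp: \<delta>_def dist_real_def)
      then show ?thesis by (simp add: dist_real_def)
    next
      case False
      with \<open>\<bar>s - t\<bar> < \<delta>\<close> have "K \<le> \<bar>s\<bar>" "K \<le> \<bar>t\<bar>" by (auto simp: \<delta>_def)
      then show ?thesis using K[of s] K[of t] by linarith
    qed
    moreover have "0 \<le> 2 * C / \<delta> * \<bar>s - t\<bar>" using C0 \<delta> by simp
    ultimately show ?thesis by linarith
  next
    case False
    have "\<bar>g s - g t\<bar> \<le> 2 * C / \<delta> * \<delta>" using C[of s] C[of t] \<delta> by simp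
    also have "\<dots> \<le> 2 * C / \<delta> * \<bar>s - t\<bar>" using False C0 \<delta> by (intro mult_left_mono) auto
    finally show ?thesis using e by linarith
  qed
  moreover have "0 \<le> 2 * C / \<delta>" using C0 \<delta> by simp
  ultimately show "\<exists>L\<ge>0. \<forall>s t. \<bar>g s - g t\<bar> \<le> e + L * \<bar>s - t\<bar>" by blast
qed

section \<open>Comparison of Riemann sums with integrals\<close>

lemma C0c_bounds:
  assumes "\<phi> \<in> C0c \<Omega>"
  obtains C R where "0 < C" "\<And>y. \<bar>\<phi> y\<bar> \<le> C" "\<And>y. \<phi> y \<noteq> 0 \<Longrightarrow> y \<in> \<Omega> \<and> norm y \<le> R"
proof -
  let ?K = "closure {x. \<phi> x \<noteq> 0}"
  have K: "compact ?K" "?K \<subseteq> \<Omega>" and cont: "continuous_on UNIV \<phi>"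
    using assms by (auto simp: C0c_def compact_support_in_def)
  obtain R where R: "\<And>y. y \<in> ?K \<Longrightarrow> norm y \<le> R"
    using compact_imp_bounded[OF K(1)] by (auto simp: bounded_iff)
  have "compact (\<phi> ` ?K)" using K(1) cont by (intro compact_continuous_image) (auto intro: continuous_on_subset)
  then obtain C where C: "\<And>y. y \<in> ?K \<Longrightarrow> \<bar>\<phi> y\<bar> \<le> C"
    using compact_imp_bounded[of "\<phi> ` ?K"] by (auto simp: bounded_iff)
  have sub: "y \<in> ?K" if "\<phi> y \<noteq> 0" for y using that closure_subset by fastforce
  \<comment> \<open>The 1 makes the bound positive, as a later division by it requires, and covers
    the points where \<open>\<phi>\<close> vanishes.\<close>
  have "\<bar>\<phi> y\<bar> \<le> max C 1" for y
    using C[of y] sub[of y] by (cases "\<phi> y = 0") auto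
  then show thesis using that[of "max C 1" R] sub R K(2) by (auto simp: subset_iff)
qed

text \<open>By \<open>riemann_sum\<close> the difference is a single integral, whose integrand
  splits into three terms: the change of \<open>\<gamma> (a m)\<close> under snapping and the shift
  \<open>c\<close>, the change of \<open>\<phi>\<close> weighted by \<open>\<gamma> (a m)\<close>,
  and the replacement of \<open>a m\<close> by \<open>t m\<close>. All three live on a fixed ball.
  The first is uniformly small there; the second is small because \<open>\<gamma> (a m)\<close> is
  bounded in \<open>L\<^sup>1\<close> of the ball; the third is small, up to a uniform error,
  because \<open>a m - t m\<close> tends to 0 in \<open>L\<^sup>1\<close>.\<close>

lemma riemann_sum_diff_tendsto:
  fixes \<phi> :: "real ^ 'k::finite \<Rightarrow> real"
  assumes \<phi>: "\<phi> \<in> C0c \<Omega>" and \<gamma>: "almost_lipschitz \<gamma>" "continuous_on UNIV \<gamma>"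
    and a: "\<And>m. integrable lebesgue (a m)" and t: "\<And>m. integrable lebesgue (t m)"
    and at: "(\<lambda>m. \<integral>y. \<bar>a m y - t m y\<bar> \<partial>lebesgue) \<longlonglongrightarrow> 0"
    and A: "\<And>m. (\<integral>y. \<bar>a m y\<bar> \<partial>lebesgue) \<le> A"
    and snap: "\<And>B e. 0 < e \<Longrightarrow> \<forall>\<^sub>F m in sequentially. \<forall>y\<in>cball 0 B. \<bar>a m (snap m y) - a m y\<bar> \<le> e"
    and c: "c \<longlonglongrightarrow> 0"
  shows "(\<lambda>m. (1 / fact m) ^ CARD('k) * (\<Sum>x\<in>grid_points \<Omega> m. \<gamma> (a m x + c m) * \<phi> x) -
    (\<integral>y. \<gamma> (t m y) * \<phi> y \<partial>lebesgue)) \<longlonglongrightarrow> 0"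
proof (rule tendstoI)
  fix \<epsilon> :: real assume \<epsilon>: "0 < \<epsilon>"
  obtain C R where C0: "0 < C" and C: "\<And>y. \<bar>\<phi> y\<bar> \<le> C"
    and R: "\<And>y. \<phi> y \<noteq> 0 \<Longrightarrow> y \<in> \<Omega> \<and> norm y \<le> R"
    using C0c_bounds[OF \<phi>] by metis
  have cont\<phi>: "continuous_on UNIV \<phi>" using \<phi> by (simp add: C0c_def)
  \<comment> \<open>Snapping moves a point by at most \<open>CARD('k)\<close>, so both
    \<open>\<phi>\<close> and \<open>\<phi> \<circ> snap m\<close> vanish outside the ball of radius
    \<open>B\<close>.\<close>
  define B where "B = R + CARD('k)"
  define I where "I = (indicator (cball 0 B) :: real ^ 'k \<Rightarrow> real)"
  have snapB: "norm y \<le> B" if "\<phi> (snap m y) \<noteq> 0" for m y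
    using R[OF that] norm_snap_diff_le_card[of m y] norm_triangle_sub[of y "snap m y"]
    by (simp add: B_def norm_minus_commute)
  have \<phi>B: "norm y \<le> B" if "\<phi> y \<noteq> 0" for y
    using R[OF that] by (simp add: B_def)
  define V where "V = measure lebesgue (cball 0 B :: (real ^ 'k) set)"
  have V0: "0 \<le> V" by (simp add: V_def)
  have I: "has_bochner_integral lebesgue I V"
    unfolding I_def V_def
    by (rule has_bochner_integral_real_indicator) (use lmeasurable_cball in \<open>auto simp: fmeasurable_def\<close>)
  \<comment> \<open>Tolerance 1 serves the linear growth bound \<open>G\<close> below; the fine
    tolerance \<open>e1\<close> comes with its own slope \<open>L\<close>.\<close>
  obtain L1 where L10: "0 \<le> L1" and L1: "\<And>s u. \<bar>\<gamma> s - \<gamma> u\<bar> \<le> 1 + L1 * \<bar>s - u\<bar>"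
    using \<gamma>(1) unfolding almost_lipschitz_def by (metis zero_less_one)
  define G where "G = \<bar>\<gamma> 0\<bar> + 1"
  have G0: "0 < G" by (simp add: G_def add_nonneg_pos)
  have G: "\<bar>\<gamma> s\<bar> \<le> G + L1 * \<bar>s\<bar>" for s using L1[of s 0] by (simp add: G_def)
  \<comment> \<open>This tolerance enters three times, each time multiplied by \<open>C * V\<close>;
    the factor 12 brings the total to at most \<open>\<epsilon> / 4\<close>, and
    \<open>V + 1\<close> avoids a division by zero.\<close>
  define e1 where "e1 = \<epsilon> / (12 * C * (V + 1))"
  have e1: "0 < e1" using \<epsilon> C0 V0 by (simp add: e1_def)
  have "3 * e1 * C * V = \<epsilon> / 4 * (V / (V + 1))" using C0 V0 by (simp add: e1_def)
  also have "\<dots> \<le> \<epsilon> / 4 * 1" using \<epsilon> V0 by (intro mult_left_mono) auto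
  finally have b1: "3 * e1 * C * V \<le> \<epsilon> / 4" by simp
  obtain L where L0: "0 \<le> L" and L: "\<And>s u. \<bar>\<gamma> s - \<gamma> u\<bar> \<le> e1 + L * \<bar>s - u\<bar>"
    using \<gamma>(1) e1 unfolding almost_lipschitz_def by metis
  \<comment> \<open>Snapping and the shift \<open>c\<close> are each allowed half of
    \<open>\<eta>\<close>, chosen so that the slope \<open>L\<close> turns their sum into at most
    \<open>e1\<close>.\<close>
  define \<eta> where "\<eta> = e1 / (L + 1)"
  have \<eta>: "0 < \<eta>" using e1 L0 by (simp add: \<eta>_def)
  have L\<eta>: "L * \<eta> \<le> e1"
  proof -
    have "L * \<eta> = e1 * (L / (L + 1))" by (simp add: \<eta>_def)
    also have "\<dots> \<le> e1 * 1" using e1 L0 by (intro mult_left_mono) auto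
    finally show ?thesis by simp
  qed
  have A0: "0 \<le> A"
    by (rule order_trans[OF Bochner_Integration.integral_nonneg A[of 0]]) simp
  \<comment> \<open>A bound, uniform in \<open>m\<close>, for the integral of
    \<open>\<bar>\<gamma> (a m y)\<bar>\<close> over the ball.\<close>
  define D where "D = G * V + L1 * A"
  have D0: "0 \<le> D" using G0 V0 L10 A0 by (simp add: D_def)
  define \<eta>' where "\<eta>' = \<epsilon> / (4 * (D + 1))"
  have \<eta>': "0 < \<eta>'" using \<epsilon> D0 by (simp add: \<eta>'_def)
  have "\<eta>' * D = \<epsilon> / 4 * (D / (D + 1))" using D0 by (simp add: \<eta>'_def field_simps)
  also have "\<dots> \<le> \<epsilon> / 4 * 1" using \<epsilon> D0 by (intro mult_left_mono) auto
  finally have b2: "\<eta>' * D \<le> \<epsilon> / 4" by simp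
  have ev1: "\<forall>\<^sub>F m in sequentially. \<forall>y\<in>cball 0 B. \<bar>a m (snap m y) - a m y\<bar> \<le> \<eta> / 2"
    using \<eta> by (intro snap) simp
  have ev2: "\<forall>\<^sub>F m in sequentially. \<bar>c m\<bar> < \<eta> / 2"
    using tendstoD[OF c, of "\<eta> / 2"] \<eta> by simp
  have ev3: "\<forall>\<^sub>F m in sequentially. \<forall>y\<in>cball 0 B. \<bar>\<phi> (snap m y) - \<phi> y\<bar> \<le> \<eta>'"
    by (rule snap_uniform[OF cont\<phi> \<eta>'])
  have ev4: "\<forall>\<^sub>F m in sequentially. L * C * (\<integral>y. \<bar>a m y - t m y\<bar> \<partial>lebesgue) < \<epsilon> / 4"
    using tendsto_mult_right_zero[OF at, of "L * C"] \<epsilon> by (intro order_tendstoD(2)) auto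
  \<comment> \<open>This puts the support of \<open>\<phi>\<close> inside the region that the
    standard grid covers, as \<open>riemann_sum\<close> demands.\<close>
  have ev5: "\<forall>\<^sub>F m in sequentially. R < fact m"
    using filterlim_fact_real unfolding filterlim_at_top_dense by blast
  show "\<forall>\<^sub>F m in sequentially. dist ((1 / fact m) ^ CARD('k) *
      (\<Sum>x\<in>grid_points \<Omega> m. \<gamma> (a m x + c m) * \<phi> x) - (\<integral>y. \<gamma> (t m y) * \<phi> y \<partial>lebesgue)) 0 < \<epsilon>"
    using ev1 ev2 ev3 ev4 ev5
  proof eventually_elim
    case (elim m)
    let ?F = "\<lambda>x. \<gamma> (a m x + c m) * \<phi> x"
    let ?S = "(1 / fact m) ^ CARD('k) * (\<Sum>x\<in>grid_points \<Omega> m. ?F x)"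
    have "x \<in> \<Omega> \<and> norm x < fact m" if "?F x \<noteq> 0" for x
      using R[of x] that elim(5) by force
    then have hbi: "has_bochner_integral lebesgue (\<lambda>y. ?F (snap m y)) ?S"
      by (rule riemann_sum)
    have [measurable]: "t m \<in> borel_measurable lebesgue" "\<gamma> \<in> borel_measurable borel"
      "\<phi> \<in> borel_measurable lebesgue"
      using t[of m] borel_measurable_continuous_onI[OF \<gamma>(2)]
        continuous_imp_lebesgue_measurable[OF cont\<phi>] by auto
    have intI: "integrable lebesgue I" "(\<integral>y. I y \<partial>lebesgue) = V"
      using I by (auto simp: has_bochner_integral_iff)
    have inta: "integrable lebesgue (\<lambda>y. \<bar>a m y\<bar>)" "integrable lebesgue (\<lambda>y. \<bar>a m y - t m y\<bar>)"
      "integrable lebesgue (\<lambda>y. \<bar>t m y\<bar>)"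
      using a[of m] t[of m] by auto
    have intt: "integrable lebesgue (\<lambda>y. \<gamma> (t m y) * \<phi> y)"
    proof (rule Bochner_Integration.integrable_bound)
      show "integrable lebesgue (\<lambda>y. G * C * I y + L1 * C * \<bar>t m y\<bar>)"
        using intI inta by simp
      show "AE y in lebesgue. norm (\<gamma> (t m y) * \<phi> y) \<le> norm (G * C * I y + L1 * C * \<bar>t m y\<bar>)"
      proof (rule AE_I2)
        fix y
        have "\<bar>\<gamma> (t m y)\<bar> * \<bar>\<phi> y\<bar> \<le> (G + L1 * \<bar>t m y\<bar>) * C" if "\<phi> y \<noteq> 0"
          using G C G0 L10 by (intro mult_mono) auto
        then have "\<bar>\<gamma> (t m y) * \<phi> y\<bar> \<le> G * C * I y + L1 * C * \<bar>t m y\<bar>"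
          using \<phi>B[of y] L10 C0 G0 by (cases "\<phi> y = 0") (auto simp: I_def abs_mult algebra_simps)
        then show "norm (\<gamma> (t m y) * \<phi> y) \<le> norm (G * C * I y + L1 * C * \<bar>t m y\<bar>)" by simp
      qed
    qed measurable
    \<comment> \<open>Of the three copies of \<open>e1 * C\<close>, two come from the first term of
      the splitting and one from the third.\<close>
    let ?H = "\<lambda>y. (3 * e1 * C + \<eta>' * G) * I y + (\<eta>' * L1 * \<bar>a m y\<bar> + L * C * \<bar>a m y - t m y\<bar>)"
    have bound: "\<bar>?F (snap m y) - \<gamma> (t m y) * \<phi> y\<bar> \<le> ?H y" for y
    proof (cases "norm y \<le> B")
      case True
      then have Iy: "I y = 1" by (simp add: I_def)
      let ?p = "\<gamma> (a m (snap m y) + c m) - \<gamma> (a m y)"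
      have "\<bar>a m (snap m y) - a m y\<bar> \<le> \<eta> / 2" using elim(1) True by simp
      then have "\<bar>a m (snap m y) + c m - a m y\<bar> \<le> \<eta>" using elim(2) by linarith
      then have "L * \<bar>a m (snap m y) + c m - a m y\<bar> \<le> e1"
        using L\<eta> L0 by (meson mult_left_mono order_trans)
      then have "\<bar>?p\<bar> \<le> 2 * e1" using L[of "a m (snap m y) + c m" "a m y"] by linarith
      then have 1: "\<bar>?p * \<phi> (snap m y)\<bar> \<le> 2 * e1 * C"
        unfolding abs_mult using C e1 by (intro mult_mono) auto
      have "\<bar>\<gamma> (a m y) * (\<phi> (snap m y) - \<phi> y)\<bar> \<le> (G + L1 * \<bar>a m y\<bar>) * \<eta>'"
        unfolding abs_mult using elim(3) True G G0 L10 by (intro mult_mono) auto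
      moreover have "\<bar>(\<gamma> (a m y) - \<gamma> (t m y)) * \<phi> y\<bar> \<le> (e1 + L * \<bar>a m y - t m y\<bar>) * C"
        unfolding abs_mult using L C e1 L0 by (intro mult_mono) auto
      moreover have "?F (snap m y) - \<gamma> (t m y) * \<phi> y = ?p * \<phi> (snap m y) +
          (\<gamma> (a m y) * (\<phi> (snap m y) - \<phi> y) + (\<gamma> (a m y) - \<gamma> (t m y)) * \<phi> y)"
        by (simp add: algebra_simps)
      ultimately have "\<bar>?F (snap m y) - \<gamma> (t m y) * \<phi> y\<bar> \<le>
          2 * e1 * C + ((G + L1 * \<bar>a m y\<bar>) * \<eta>' + (e1 + L * \<bar>a m y - t m y\<bar>) * C)"
        using 1 by linarith
      also have "\<dots> = ?H y" by (simp add: Iy algebra_simps)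
      finally show ?thesis .
    next
      case False
      then have "\<phi> y = 0" "\<phi> (snap m y) = 0" using \<phi>B snapB by blast+
      moreover have "0 \<le> ?H y" using e1 C0 \<eta>' G0 L10 L0 by (simp add: I_def)
      ultimately show ?thesis by simp
    qed
    have "?S - (\<integral>y. \<gamma> (t m y) * \<phi> y \<partial>lebesgue) = (\<integral>y. ?F (snap m y) - \<gamma> (t m y) * \<phi> y \<partial>lebesgue)"
      using hbi intt by (simp add: has_bochner_integral_iff)
    also have "\<bar>\<dots>\<bar> \<le> (\<integral>y. \<bar>?F (snap m y) - \<gamma> (t m y) * \<phi> y\<bar> \<partial>lebesgue)"
      by (rule integral_abs_bound)
    also have "\<dots> \<le> (\<integral>y. ?H y \<partial>lebesgue)"
      using hbi intt intI inta bound by (intro integral_mono) (auto simp: has_bochner_integral_iff)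
    also have "\<dots> = (3 * e1 * C + \<eta>' * G) * V + (\<eta>' * L1 * (\<integral>y. \<bar>a m y\<bar> \<partial>lebesgue) +
        L * C * (\<integral>y. \<bar>a m y - t m y\<bar> \<partial>lebesgue))"
      using intI inta by simp
    also have "\<dots> \<le> (3 * e1 * C + \<eta>' * G) * V + (\<eta>' * L1 * A +
        L * C * (\<integral>y. \<bar>a m y - t m y\<bar> \<partial>lebesgue))"
      using A[of m] \<eta>' L10 by (intro add_left_mono add_right_mono mult_left_mono) auto
    also have "\<dots> = 3 * e1 * C * V + \<eta>' * D + L * C * (\<integral>y. \<bar>a m y - t m y\<bar> \<partial>lebesgue)"
      by (simp add: D_def algebra_simps)
    also have "\<dots> < \<epsilon>" using b1 b2 elim(4) \<epsilon> by linarith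
    finally show ?case by (simp add: dist_real_def)
  qed
qed

text \<open>Extending \<open>f\<close> by zero may change \<open>\<gamma> (f x)\<close> outside
  \<open>\<Omega>\<close>, where \<open>\<gamma> 0\<close> appears, but \<open>\<phi>\<close>
  vanishes there.\<close>

lemma set_lebesgue_integral_C0c:
  fixes f :: "'a::euclidean_space \<Rightarrow> real" and \<gamma> :: "real \<Rightarrow> real"
  assumes "\<phi> \<in> C0c \<Omega>"
  shows "(LINT x:\<Omega>|lebesgue. \<gamma> (f x) * \<phi> x) = (\<integral>x. \<gamma> (indicator \<Omega> x * f x) * \<phi> x \<partial>lebesgue)"
  unfolding set_lebesgue_integral_def
proof (rule Bochner_Integration.integral_cong[OF refl])
  fix x
  show "indicator \<Omega> x *\<^sub>R (\<gamma> (f x) * \<phi> x) = \<gamma> (indicator \<Omega> x * f x) * \<phi> x"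
  proof (cases "x \<in> \<Omega>")
    case False
    then have "\<phi> x = 0" using C0c_bounds[OF assms] by metis
    with False show ?thesis by simp
  qed simp
qed

text \<open>The samples \<open>H\<close> are fixed before \<open>c\<close>, \<open>\<gamma>\<close>,
  \<open>\<phi>\<close> and \<open>l\<close>, so the same ones serve both convergence claims; the
  null sequence \<open>c\<close> leaves room for a second grid function.\<close>

lemma grid_sampling:
  fixes z :: "nat \<Rightarrow> real ^ 'k::finite \<Rightarrow> real"
  assumes z: "bounded_L1_sequence \<Omega> z"
  obtains H where "\<And>c \<gamma> \<phi> l. c \<longlonglongrightarrow> 0 \<Longrightarrow> almost_lipschitz \<gamma> \<Longrightarrow> continuous_on UNIV \<gamma> \<Longrightarrow> \<phi> \<in> C0c \<Omega> \<Longrightarrow>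
      (\<lambda>n. LINT x:\<Omega>|lebesgue. \<gamma> (z n x) * \<phi> x) \<longlonglongrightarrow> l \<Longrightarrow>
      (\<lambda>m. (1 / fact m) ^ CARD('k) * (\<Sum>x\<in>grid_points \<Omega> m. \<gamma> (H m x + c m) * \<phi> x)) \<longlonglongrightarrow> l"
proof -
  obtain A where int: "\<And>n. set_integrable lebesgue \<Omega> (z n)"
    and A: "\<And>n. (LINT x:\<Omega>|lebesgue. \<bar>z n x\<bar>) \<le> A"
    using z by (auto simp: bounded_L1_sequence_def)
  define t where "t n x = indicator \<Omega> x * z n x" for n x
  have t: "integrable lebesgue (t n)" for n
    using int[of n] by (simp add: set_integrable_def t_def[abs_def])
  have tA: "(\<integral>x. \<bar>t n x\<bar> \<partial>lebesgue) \<le> A" for n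
    using A[of n] by (simp add: set_lebesgue_integral_def t_def abs_mult)
  have "\<exists>w. continuous_on UNIV w \<and> integrable lebesgue w \<and>
      (\<integral>y. \<bar>w y - t n y\<bar> \<partial>lebesgue) < 1 / Suc n" for n
    using L1_approx_continuous[OF t[of n], of "1 / Suc n"] by (metis of_nat_0_less_iff zero_less_Suc zero_less_divide_1_iff)
  then obtain w where contw: "\<And>n. continuous_on UNIV (w n)" and intw: "\<And>n. integrable lebesgue (w n)"
    and w: "\<And>n. (\<integral>y. \<bar>w n y - t n y\<bar> \<partial>lebesgue) < 1 / Suc n"
    by metis
  \<comment> \<open>Ball and tolerance both vary with \<open>n\<close>, so that the diagonal choice
    eventually beats every fixed ball and every fixed tolerance.\<close>
  have "\<forall>\<^sub>F m in sequentially. \<forall>y\<in>cball 0 (real n). \<bar>w n (snap m y) - w n y\<bar> \<le> 1 / Suc n" for n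
    by (rule snap_uniform[OF contw]) simp
  then obtain f where f: "filterlim f at_top sequentially"
    and snap: "\<forall>\<^sub>F m in sequentially. \<forall>y\<in>cball 0 (real (f m)).
      \<bar>w (f m) (snap m y) - w (f m) y\<bar> \<le> 1 / Suc (f m)"
    by (rule diagonal_sequence)
  have inv: "(\<lambda>m. 1 / Suc (f m)) \<longlonglongrightarrow> 0"
    using filterlim_compose[OF LIMSEQ_inverse_real_of_nat f] by (simp add: inverse_eq_divide)
  show thesis
  proof (rule that[of "\<lambda>m. w (f m)"])
    fix c :: "nat \<Rightarrow> real" and \<gamma> :: "real \<Rightarrow> real" and \<phi> :: "real ^ 'k \<Rightarrow> real" and l
    assume c: "c \<longlonglongrightarrow> 0" and \<gamma>: "almost_lipschitz \<gamma>" "continuous_on UNIV \<gamma>" and \<phi>: "\<phi> \<in> C0c \<Omega>"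
      and l: "(\<lambda>n. LINT x:\<Omega>|lebesgue. \<gamma> (z n x) * \<phi> x) \<longlonglongrightarrow> l"
    have "(\<lambda>m. (1 / fact m) ^ CARD('k) * (\<Sum>x\<in>grid_points \<Omega> m. \<gamma> (w (f m) x + c m) * \<phi> x) -
        (\<integral>y. \<gamma> (t (f m) y) * \<phi> y \<partial>lebesgue)) \<longlonglongrightarrow> 0"
    proof (rule riemann_sum_diff_tendsto[OF \<phi> \<gamma> intw t _ _ _ c])
      show "(\<lambda>m. \<integral>y. \<bar>w (f m) y - t (f m) y\<bar> \<partial>lebesgue) \<longlonglongrightarrow> 0"
        by (rule tendsto_sandwich[OF _ _ tendsto_const inv])
           (intro always_eventually allI less_imp_le[OF w] Bochner_Integration.integral_nonneg abs_ge_zero)+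
      show "(\<integral>y. \<bar>w (f m) y\<bar> \<partial>lebesgue) \<le> A + 1" for m
      proof -
        have "(\<integral>y. \<bar>w (f m) y\<bar> \<partial>lebesgue) \<le>
            (\<integral>y. \<bar>w (f m) y - t (f m) y\<bar> + \<bar>t (f m) y\<bar> \<partial>lebesgue)"
          using intw[of "f m"] t[of "f m"] by (intro integral_mono) auto
        also have "\<dots> = (\<integral>y. \<bar>w (f m) y - t (f m) y\<bar> \<partial>lebesgue) + (\<integral>y. \<bar>t (f m) y\<bar> \<partial>lebesgue)"
          using intw[of "f m"] t[of "f m"] by (intro Bochner_Integration.integral_add) auto
        also have "\<dots> \<le> 1 / Suc (f m) + A"
          using w[of "f m"] tA[of "f m"] by linarith
        also have "\<dots> \<le> A + 1" by simp
        finally show ?thesis .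
      qed
      fix B e :: real assume e: "0 < e"
      have "\<forall>\<^sub>F m in sequentially. 1 / Suc (f m) < e" using inv e by (intro order_tendstoD(2))
      moreover have "\<forall>\<^sub>F m in sequentially. B \<le> real (f m)"
        using filterlim_compose[OF filterlim_real_sequentially f] unfolding filterlim_at_top by blast
      ultimately show "\<forall>\<^sub>F m in sequentially. \<forall>y\<in>cball 0 B. \<bar>w (f m) (snap m y) - w (f m) y\<bar> \<le> e"
        using snap
      proof eventually_elim
        case (elim m)
        show ?case
        proof
          fix y :: "real ^ 'k" assume "y \<in> cball 0 B"
          then have "y \<in> cball 0 (real (f m))" using elim(2) by auto
          with elim(1,3) show "\<bar>w (f m) (snap m y) - w (f m) y\<bar> \<le> e" by fastforce
        qed
      qed
    qed
    moreover have "(\<lambda>m. \<integral>y. \<gamma> (t (f m) y) * \<phi> y \<partial>lebesgue) \<longlonglongrightarrow> l"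
      using filterlim_compose[OF l f] unfolding set_lebesgue_integral_C0c[OF \<phi>] t_def .
    ultimately show "(\<lambda>m. (1 / fact m) ^ CARD('k) *
        (\<Sum>x\<in>grid_points \<Omega> m. \<gamma> (w (f m) x + c m) * \<phi> x)) \<longlonglongrightarrow> l"
      using tendsto_add by fastforce
  qed
qed

text \<open>A point with a ball around it in \<open>\<Omega>\<close> rounds to a lattice point that,
  for large \<open>m\<close>, is still in \<open>\<Omega>\<close> and within the cut-off.
  Non-uniqueness needs such a point as the place where two grid functions differ.\<close>

lemma grid_points_nonempty:
  fixes \<Omega> :: "(real ^ 'k::finite) set"
  assumes "open \<Omega>" "\<Omega> \<noteq> {}"
  shows "\<forall>\<^sub>F m in sequentially. grid_points \<Omega> m \<noteq> {}"
proof -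
  obtain x e where e: "0 < e" "ball x e \<subseteq> \<Omega>" using assms openE by blast
  have "(\<lambda>m. CARD('k) / (fact m :: real)) \<longlonglongrightarrow> 0"
    by (rule tendsto_divide_0[OF tendsto_const])
       (rule filterlim_at_top_imp_at_infinity[OF filterlim_fact_real])
  then have "\<forall>\<^sub>F m in sequentially. CARD('k) / (fact m :: real) < e"
    using e(1) order_tendstoD(2) by blast
  moreover have "\<forall>\<^sub>F m in sequentially. norm x + CARD('k) < fact m"
    using filterlim_fact_real unfolding filterlim_at_top_dense by blast
  ultimately show ?thesis
  proof eventually_elim
    case (elim m)
    have "dist x (snap m x) < e"
      using elim(1) norm_snap_diff_le[of m x] by (simp add: dist_norm norm_minus_commute)
    then have "snap m x \<in> \<Omega>" using e(2) by auto
    moreover have "norm (snap m x) < fact m"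
      using elim(2) norm_snap_diff_le_card[of m x] norm_triangle_sub[of "snap m x" x] by linarith
    ultimately show ?case using snap_in_grid_points by blast
  qed
qed

section \<open>Transfer at the infinite index\<close>

definition Imp :: "'s form \<Rightarrow> 's form \<Rightarrow> 's form" where
  "Imp p q = Neg (Conj p (Neg q))"

definition Ex :: "nat \<Rightarrow> 's form \<Rightarrow> 's form" where
  "Ex x p = Neg (All x (Neg p))"

text \<open>The trivial equation \<open>Equal 0 0\<close> stands in for a true formula, which is not
  a primitive of the syntax.\<close>

primrec Conjs :: "'s form list \<Rightarrow> 's form" where
  "Conjs [] = Equal 0 0"
| "Conjs (p # ps) = Conj p (Conjs ps)"

lemma sat_Imp [simp]: "sat I (Imp p q) e \<longleftrightarrow> (sat I p e \<longrightarrow> sat I q e)"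
  by (simp add: Imp_def)

lemma sat_Ex [simp]: "sat I (Ex x p) e \<longleftrightarrow> (\<exists>a. sat I p (e(x := a)))"
  by (simp add: Ex_def)

lemma sat_Conjs [simp]: "sat I (Conjs ps) e \<longleftrightarrow> (\<forall>p\<in>set ps. sat I p e)"
  by (induction ps) auto

text \<open>Serves to bind a whole list of variables at once in \<open>germ_transfer\<close>. In the
  induction, the value to choose for \<open>x\<close> is \<open>e' x\<close>.\<close>

lemma sat_foldr_All:
  "sat I (foldr All vs p) e \<longleftrightarrow> (\<forall>e'. (\<forall>v. v \<notin> set vs \<longrightarrow> e' v = e v) \<longrightarrow> sat I p e')"
proof (induction vs arbitrary: e)
  case Nil
  have "e' = e" if "\<forall>v. e' v = e v" for e' using that by auto
  then show ?case by auto
next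
  case (Cons x vs)
  have "(\<exists>a. \<forall>v. v \<notin> set vs \<longrightarrow> e' v = (e(x := a)) v) \<longleftrightarrow>
        (\<forall>v. v \<notin> set (x # vs) \<longrightarrow> e' v = e v)" for e'
  proof
    assume "\<forall>v. v \<notin> set (x # vs) \<longrightarrow> e' v = e v"
    then have "\<forall>v. v \<notin> set vs \<longrightarrow> e' v = (e(x := e' x)) v" by auto
    then show "\<exists>a. \<forall>v. v \<notin> set vs \<longrightarrow> e' v = (e(x := a)) v" ..
  qed auto
  then show ?case
    unfolding foldr.simps o_apply sat.simps Cons.IH by blast
qed

section \<open>Values of extended functions\<close>

lemma transfer:
  "nonstandard_extension S \<Longrightarrow> sat (\<lambda>R. R) p e \<longleftrightarrow> sat (ext S) p (std S \<circ> e)"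
  unfolding nonstandard_extension_def by blast

definition unary :: "'s set \<Rightarrow> 's list set" where
  "unary A = (\<lambda>a. [a]) ` A"

lemma unary_iff: "[x] \<in> unary A \<longleftrightarrow> x \<in> A"
  by (auto simp: unary_def)

lemma star_set_iff: "x \<in> star_set S A \<longleftrightarrow> [x] \<in> ext S (unary A)"
  by (simp add: star_set_def unary_def)

text \<open>Functionality of \<open>G\<close> is a first-order sentence, so \<open>ext S G\<close>
  is functional too and the description in \<open>star_app\<close> denotes \<open>y\<close>. The
  sentence is closed, so any assignment will do.\<close>

lemma star_app1_eq:
  assumes "nonstandard_extension S"
    and "\<And>a y y'. [a, y] \<in> G \<Longrightarrow> [a, y'] \<in> G \<Longrightarrow> y = y'"
    and "[x, y] \<in> ext S G"
  shows "star_app S G [x] = y"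
proof -
  have "[a, y] \<in> ext S G \<Longrightarrow> [a, y'] \<in> ext S G \<Longrightarrow> y = y'" for a y y'
    using transfer[OF assms(1), of "All 0 (All 1 (All 2
      (Imp (Conj (Atom G [0, 1]) (Atom G [0, 2])) (Equal 1 2))))" undefined]
    by (simp add: fun_upd_def) (metis assms(2))
  with assms(3) show ?thesis unfolding star_app_def by auto
qed

lemma star_app2_eq:
  assumes "nonstandard_extension S"
    and "\<And>a b y y'. [a, b, y] \<in> G \<Longrightarrow> [a, b, y'] \<in> G \<Longrightarrow> y = y'"
    and "[x, x', y] \<in> ext S G"
  shows "star_app S G [x, x'] = y"
proof -
  have "[a, b, y] \<in> ext S G \<Longrightarrow> [a, b, y'] \<in> ext S G \<Longrightarrow> y = y'" for a b y y'
    using transfer[OF assms(1), of "All 0 (All 1 (All 2 (All 3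
      (Imp (Conj (Atom G [0, 1, 2]) (Atom G [0, 1, 3])) (Equal 2 3)))))" undefined]
    by (simp add: fun_upd_def) (metis assms(2))
  with assms(3) show ?thesis unfolding star_app_def by auto
qed

text \<open>Totality of \<open>G\<close> on \<open>D\<close> transfers and supplies the value that
  the description picks.\<close>

lemma star_app1_mem:
  assumes "nonstandard_extension S"
    and "\<And>a y y'. [a, y] \<in> G \<Longrightarrow> [a, y'] \<in> G \<Longrightarrow> y = y'"
    and "\<And>a. a \<in> D \<Longrightarrow> \<exists>y. [a, y] \<in> G"
    and "x \<in> star_set S D"
  shows "[x, star_app S G [x]] \<in> ext S G"
proof -
  have "\<exists>y. [x, y] \<in> ext S G"
    using transfer[OF assms(1), of "All 0 (Imp (Atom (unary D) [0]) (Ex 1 (Atom G [0, 1])))" undefined]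
      assms(3,4)
    by (auto simp: star_set_iff unary_iff)
  then obtain y where y: "[x, y] \<in> ext S G" ..
  have "star_app S G [x] = y" by (rule star_app1_eq[OF assms(1) _ y]) (rule assms(2))
  with y show ?thesis by simp
qed

lemma star_app2_mem:
  assumes "nonstandard_extension S"
    and "\<And>a b y y'. [a, b, y] \<in> G \<Longrightarrow> [a, b, y'] \<in> G \<Longrightarrow> y = y'"
    and "\<And>a b. a \<in> D \<Longrightarrow> b \<in> E \<Longrightarrow> \<exists>y. [a, b, y] \<in> G"
    and "x \<in> star_set S D" and "x' \<in> star_set S E"
  shows "[x, x', star_app S G [x, x']] \<in> ext S G"
proof -
  have "\<exists>y. [x, x', y] \<in> ext S G"
    using transfer[OF assms(1), of "All 0 (All 1 (Imp (Conj (Atom (unary D) [0])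
      (Atom (unary E) [1])) (Ex 2 (Atom G [0, 1, 2]))))" undefined]
      assms(3-5)
    by (auto simp: star_set_iff unary_iff)
  then obtain y where y: "[x, x', y] \<in> ext S G" ..
  have "star_app S G [x, x'] = y" by (rule star_app2_eq[OF assms(1) _ y]) (rule assms(2))
  with y show ?thesis by simp
qed

section \<open>Values of extended sequences at the infinite index\<close>

definition seq_graph :: "(nat \<Rightarrow> 'k::finite obj) \<Rightarrow> 'k obj list set" where
  "seq_graph F = {[Num (real m), F m] | m. True}"

text \<open>The value \<open>*F(N0)\<close> of the extended sequence: the bridge from a standard
  sequence of objects to one internal object.\<close>

definition germ :: "('k::finite, 'n) real_extension \<Rightarrow> 'n \<Rightarrow> (nat \<Rightarrow> 'k obj) \<Rightarrow> 'n" where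
  "germ S N0 F = star_app S (seq_graph F) [N0]"

locale hyper =
  fixes S :: "('k::finite, 'n) real_extension" and N0 :: 'n
  assumes ns: "nonstandard_extension S"
    and inf: "infinite_hypernat S N0"
begin

abbreviation gm where "gm \<equiv> germ S N0"

lemma N0_nat: "N0 \<in> star_set S (Num ` \<nat>)"
  using inf by (simp add: infinite_hypernat_def hypernats_def)

lemma germ_mem: "[N0, gm F] \<in> ext S (seq_graph F)"
  unfolding germ_def
  by (rule star_app1_mem[OF ns _ _ N0_nat]) (auto simp: seq_graph_def Nats_def)

text \<open>Here the infinity of \<open>N0\<close> enters: a hypernatural above every standard
  \<open>m0\<close> lies in the extension of every tail of the naturals. Hence what holds eventually
  holds at \<open>N0\<close>.\<close>

lemma N0_tail: "[N0] \<in> ext S {[Num (real m)] | m. m0 \<le> m}"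
proof -
  have "[N0] \<in> ext S (unary (Num ` \<nat>))" using N0_nat by (simp add: star_set_iff unary_iff)
  moreover have "[std S (Num (real m0)), N0] \<in> ext S {[Num a, Num b] | a b. a < b}"
    using inf by (simp add: infinite_hypernat_def hless_def)
  ultimately show ?thesis
    using transfer[OF ns, of "All 0 (Imp (Conj (Atom (unary (Num ` \<nat>)) [0])
      (Atom {[Num a, Num b] | a b. a < b} [1, 0])) (Atom {[Num (real m)] | m. m0 \<le> m} [0]))"
      "\<lambda>_. Num (real m0)"]
    by (auto simp: Nats_def unary_iff)
qed

lemma germ_id: "gm (\<lambda>m. Num (real m)) = N0"
proof -
  have "[N0, N0] \<in> ext S (seq_graph (\<lambda>m. Num (real m)))"
    using transfer[OF ns, of "All 0 (Imp (Atom {[Num (real m)] | m. 0 \<le> m} [0])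
       (Atom (seq_graph (\<lambda>m. Num (real m))) [0, 0]))" undefined] N0_tail[of 0]
    by (auto simp: seq_graph_def)
  then show ?thesis unfolding germ_def
    by (intro star_app1_eq[OF ns]) (auto simp: seq_graph_def)
qed

text \<open>A germ is tied to its index only through \<open>seq_graph\<close>, so the list has to start with \<open>N0\<close>
  itself.\<close>

lemma germ_transfer:
  assumes Fs: "Fs \<noteq> []" "hd Fs = (\<lambda>m. Num (real m))"
    and ev: "\<forall>\<^sub>F m in sequentially. sat (\<lambda>R. R) p (\<lambda>v. if v < length Fs then (Fs ! v) m else d)"
  shows "sat (ext S) p (\<lambda>v. if v < length Fs then gm (Fs ! v) else std S d)"
proof -
  obtain m0 where m0: "\<And>m. m0 \<le> m \<Longrightarrow>
      sat (\<lambda>R. R) p (\<lambda>v. if v < length Fs then (Fs ! v) m else d)"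
    using ev by (auto simp: eventually_sequentially)
  define K where "K = length Fs"
  \<comment> \<open>The formula quantifies the index, in variable 0, together with the values of all
    listed sequences at it. Once transferred, it is instantiated with \<open>N0\<close> and the
    germs; variables beyond the list keep the default \<open>d\<close>.\<close>
  define q where "q = foldr All [0..<K] (Imp (Conj (Atom {[Num (real m)] | m. m0 \<le> m} [0])
    (Conjs (map (\<lambda>j. Atom (seq_graph (Fs ! j)) [0, j]) [0..<K]))) p)"
  have "sat (\<lambda>R. R) q (\<lambda>_. d)"
    unfolding q_def sat_foldr_All
  proof (intro allI impI)
    fix e' assume e': "\<forall>v. v \<notin> set [0..<K] \<longrightarrow> e' v = d"
    show "sat (\<lambda>R. R) (Imp (Conj (Atom {[Num (real m)] | m. m0 \<le> m} [0])
      (Conjs (map (\<lambda>j. Atom (seq_graph (Fs ! j)) [0, j]) [0..<K]))) p) e'"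
    proof (simp, intro impI, elim conjE exE)
      fix m assume m: "e' 0 = Num (real m)" "m0 \<le> m"
        and *: "\<forall>j\<in>{0..<K}. [e' 0, e' j] \<in> seq_graph (Fs ! j)"
      have "e' = (\<lambda>v. if v < length Fs then (Fs ! v) m else d)"
        using e' m * by (auto simp: K_def seq_graph_def)
      then show "sat (\<lambda>R. R) p e'" using m0[OF m(2)] by simp
    qed
  qed
  then have "sat (ext S) q (std S \<circ> (\<lambda>_. d))" using transfer[OF ns] by blast
  then show ?thesis
    unfolding q_def sat_foldr_All
  proof (elim allE impE)
    define E where "E = (\<lambda>v. if v < length Fs then gm (Fs ! v) else std S d)"
    show "\<forall>v. v \<notin> set [0..<K] \<longrightarrow> E v = (std S \<circ> (\<lambda>_. d)) v"
      by (simp add: E_def K_def)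
    have E0: "E 0 = N0" using Fs germ_id by (simp add: E_def hd_conv_nth)
    assume "sat (ext S) (Imp (Conj (Atom {[Num (real m)] | m. m0 \<le> m} [0])
      (Conjs (map (\<lambda>j. Atom (seq_graph (Fs ! j)) [0, j]) [0..<K]))) p) E"
    then show "sat (ext S) p E"
      using N0_tail[of m0] germ_mem by (simp add: E0) (simp add: E_def K_def)
  qed
qed

lemma germ_rel:
  assumes "\<forall>\<^sub>F m in sequentially. map (\<lambda>F. F m) Fs \<in> R"
  shows "map gm Fs \<in> ext S R"
proof -
  \<comment> \<open>The index is prepended because \<open>germ_transfer\<close> expects it as
    variable 0; the entries of \<open>Fs\<close> are then the variables from \<open>Suc 0\<close>
    on.\<close>
  let ?Fs = "(\<lambda>m. Num (real m)) # Fs"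
  have *: "map (\<lambda>v. if v < length ?Fs then h (?Fs ! v) else d) [Suc 0..<length ?Fs] = map h Fs"
    for h :: "(nat \<Rightarrow> 'k obj) \<Rightarrow> 'b" and d
    by (rule nth_equalityI) (auto simp del: upt_Suc)
  have "sat (ext S) (Atom R [Suc 0..<length ?Fs])
      (\<lambda>v. if v < length ?Fs then gm (?Fs ! v) else std S (Num 0))"
  proof (rule germ_transfer)
    show "\<forall>\<^sub>F m in sequentially. sat (\<lambda>R. R) (Atom R [Suc 0..<length ?Fs])
        (\<lambda>v. if v < length ?Fs then (?Fs ! v) m else Num 0)"
    proof (rule eventually_mono[OF assms])
      fix m assume "map (\<lambda>F. F m) Fs \<in> R"
      then show "sat (\<lambda>R. R) (Atom R [Suc 0..<length ?Fs])
          (\<lambda>v. if v < length ?Fs then (?Fs ! v) m else Num 0)"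
        unfolding sat.simps *[of "\<lambda>F. F m"] .
    qed
  qed auto
  then show ?thesis unfolding sat.simps *[of gm] .
qed

lemma germ_const: "gm (\<lambda>_. c) = std S c"
proof -
  have "[N0, std S c] \<in> ext S (seq_graph (\<lambda>_. c))"
    \<comment> \<open>Variable 1 stays free and receives \<open>c\<close> from the
      assignment.\<close>
    using transfer[OF ns, of "All 0 (Imp (Atom {[Num (real m)] | m. 0 \<le> m} [0])
       (Atom (seq_graph (\<lambda>_. c)) [0, 1]))" "\<lambda>_. c"] N0_tail[of 0]
    by (auto simp: seq_graph_def)
  then show ?thesis unfolding germ_def
    by (intro star_app1_eq[OF ns]) (auto simp: seq_graph_def)
qed

lemma star_app_germ:
  assumes "\<And>a y y'. [a, y] \<in> G \<Longrightarrow> [a, y'] \<in> G \<Longrightarrow> y = y'"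
    and "\<And>m. [F m, F' m] \<in> G"
  shows "star_app S G [gm F] = gm F'"
  using germ_rel[of "[F, F']" G] assms by (intro star_app1_eq[OF ns]) auto

lemma star_app_germ2:
  assumes "\<And>a b y y'. [a, b, y] \<in> G \<Longrightarrow> [a, b, y'] \<in> G \<Longrightarrow> y = y'"
    and "\<And>m. [F m, F' m, F'' m] \<in> G"
  shows "star_app S G [gm F, gm F'] = gm F''"
  using germ_rel[of "[F, F', F'']" G] assms by (intro star_app2_eq[OF ns]) auto

lemma germ_star_set: "(\<And>m. F m \<in> A) \<Longrightarrow> gm F \<in> star_set S A"
  using germ_rel[of "[F]" "unary A"] by (auto simp: star_set_iff unary_iff)

lemma hfun_germ: "hfun S g (gm (\<lambda>m. Num (s m))) = gm (\<lambda>m. Num (g (s m)))"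
  unfolding hfun_def by (rule star_app_germ) auto

lemma htimes_germ:
  "htimes S (gm (\<lambda>m. Num (s m))) (gm (\<lambda>m. Num (t m))) = gm (\<lambda>m. Num (s m * t m))"
  unfolding htimes_def by (rule star_app_germ2) auto

lemma hminus_germ:
  "hminus S (gm (\<lambda>m. Num (s m))) (gm (\<lambda>m. Num (t m))) = gm (\<lambda>m. Num (s m - t m))"
  unfolding hminus_def by (rule star_app_germ2) auto

lemma hless_germ:
  "\<forall>\<^sub>F m in sequentially. s m < t m \<Longrightarrow> hless S (gm (\<lambda>m. Num (s m))) (gm (\<lambda>m. Num (t m)))"
  unfolding hless_def
  using germ_rel[of "[\<lambda>m. Num (s m), \<lambda>m. Num (t m)]"] by simp

text \<open>For each standard \<open>r > 0\<close> the two bounds on \<open>s m - l\<close> hold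
  eventually, hence at \<open>N0\<close>.\<close>

lemma approx_germ:
  assumes "s \<longlonglongrightarrow> l"
  shows "approx S (gm (\<lambda>m. Num (s m))) (std S (Num l))"
proof -
  have "(\<lambda>m. s m - l) \<longlonglongrightarrow> 0" using assms LIM_zero_iff by blast
  then have "\<forall>\<^sub>F m in sequentially. - r < s m - l" "\<forall>\<^sub>F m in sequentially. s m - l < r"
    if "r > 0" for r using that by (auto intro: order_tendstoD)
  then show ?thesis
    unfolding approx_def
    by (simp add: germ_const[symmetric] hminus_germ hless_germ)
qed

lemma grid_N_germ: "grid_N S N0 = gm (\<lambda>m. Num (fact m))"
proof -
  have "hfact S (gm (\<lambda>m. Num (real m))) = gm (\<lambda>m. Num (fact m))"
    unfolding hfact_def by (rule star_app_germ) auto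
  then show ?thesis by (simp add: grid_N_def germ_id)
qed

lemma grid_eps_germ: "grid_eps S N0 = gm (\<lambda>m. Num (1 / fact m))"
  by (simp add: grid_eps_def grid_N_germ hfun_germ)

end

section \<open>The hyperfinite grid as a value of the standard grids\<close>

lemma grid_coords_iff:
  "x \<in> grid_coords m \<longleftrightarrow>
     (\<exists>j. j \<in> \<int> \<and> - ((fact m)\<^sup>2) \<le> j \<and> j \<le> (fact m)\<^sup>2 \<and> x = j * (1 / fact m))"
proof -
  have "real_of_int (- ((fact m)\<^sup>2)) \<le> of_int j \<longleftrightarrow> - ((fact m)\<^sup>2) \<le> j"
    "real_of_int j \<le> of_int ((fact m)\<^sup>2) \<longleftrightarrow> j \<le> (fact m)\<^sup>2" for j
    by (simp_all only: of_int_le_iff)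
  then show ?thesis
    by (fastforce simp: grid_coords_def Ints_def)
qed

text \<open>This and the following definitions name the anonymous relations of the nonstandard
  operations, so that these can be folded and the names put into formulas; \<open>rel_iffs\<close>
  gives the standard readings.\<close>

definition mem_rel :: "'k::finite obj list set" where
  "mem_rel = {[Pt p, PtSet F] | p F. p \<in> F}"

definition app_rel :: "'k::finite obj list set" where
  "app_rel = {[Fun h, Pt p, Num (h p)] | h p. True}"

definition times_rel :: "'k::finite obj list set" where
  "times_rel = {[Num a, Num b, Num (a * b)] | a b. True}"

definition le_rel :: "'k::finite obj list set" where
  "le_rel = {[Num a, Num b] | a b. a \<le> b}"

definition sum_rel :: "'k::finite obj list set" where
  "sum_rel = {[PtSet F, Fun h, Num (\<Sum>p\<in>F. h p)] | F h. finite F}"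

definition fun_rel :: "(real \<Rightarrow> real) \<Rightarrow> 'k::finite obj list set" where
  "fun_rel g = {[Num a, Num (g a)] | a. True}"

definition fun_pt_rel :: "(real ^ 'k \<Rightarrow> real) \<Rightarrow> 'k::finite obj list set" where
  "fun_pt_rel g = {[Pt p, Num (g p)] | p. True}"

lemma rel_iffs:
  "[x, y] \<in> mem_rel \<longleftrightarrow> (\<exists>p F. x = Pt p \<and> y = PtSet F \<and> p \<in> F)"
  "[x, y, w] \<in> app_rel \<longleftrightarrow> (\<exists>h p. x = Fun h \<and> y = Pt p \<and> w = Num (h p))"
  "[x, y, w] \<in> times_rel \<longleftrightarrow> (\<exists>a b. x = Num a \<and> y = Num b \<and> w = Num (a * b))"
  "[x, y] \<in> le_rel \<longleftrightarrow> (\<exists>a b. x = Num a \<and> y = Num b \<and> a \<le> b)"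
  "[x, y, w] \<in> sum_rel \<longleftrightarrow> (\<exists>F h. x = PtSet F \<and> y = Fun h \<and> w = Num (\<Sum>p\<in>F. h p) \<and> finite F)"
  "[x, y] \<in> fun_rel g \<longleftrightarrow> (\<exists>a. x = Num a \<and> y = Num (g a))"
  "[x, y] \<in> fun_pt_rel \<phi> \<longleftrightarrow> (\<exists>p. x = Pt p \<and> y = Num (\<phi> p))"
  by (auto simp: mem_rel_def app_rel_def times_rel_def le_rel_def sum_rel_def fun_rel_def fun_pt_rel_def)

lemmas hfun_rel = hfun_def[folded fun_rel_def]
lemmas hfun_pt_rel = hfun_pt_def[folded fun_pt_rel_def]
lemmas htimes_rel = htimes_def[folded times_rel_def]
lemmas hle_rel = hle_def[folded le_rel_def]
lemmas represents_rel = represents_def[folded app_rel_def]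
lemmas hyper_sum_rel = hyper_sum_def[folded mem_rel_def sum_rel_def]

context hyper begin

abbreviation gridset where "gridset \<Omega> \<equiv> gm (\<lambda>m. PtSet (grid_points \<Omega> m))"

text \<open>Existence and uniqueness of the values of \<open>star_app\<close> allow them to be
  replaced by witnesses \<open>j\<close> and \<open>y\<close> tied by atoms. The right-hand side is
  then the nonstandard reading of a first-order formula, as the proof of \<open>grid_iff\<close>
  requires.\<close>

lemma hcoord_mem_grid1:
  assumes x: "x \<in> star_set S (range Pt)"
  shows "hcoord S i x \<in> grid1 S N0 \<longleftrightarrow>
    (\<exists>j y. [j] \<in> ext S (unary (Num ` \<int>)) \<and>
      [gm (\<lambda>m. Num (- ((fact m)\<^sup>2))), j] \<in> ext S le_rel \<and> [j, gm (\<lambda>m. Num ((fact m)\<^sup>2))] \<in> ext S le_rel \<and>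
      [j, gm (\<lambda>m. Num (1 / fact m)), y] \<in> ext S times_rel \<and>
      [x, y] \<in> ext S (fun_pt_rel (\<lambda>p. p $ i)))" (is "_ \<longleftrightarrow> ?R")
proof -
  let ?e = "gm (\<lambda>m. Num (1 / fact m))"
  have c: "[x, hcoord S i x] \<in> ext S (fun_pt_rel (\<lambda>p. p $ i))"
    unfolding hcoord_def hfun_pt_rel using x
    by (intro star_app1_mem[OF ns]) (auto simp: rel_iffs)
  have cu: "y = hcoord S i x" if "[x, y] \<in> ext S (fun_pt_rel (\<lambda>p. p $ i))" for y
    unfolding hcoord_def hfun_pt_rel using star_app1_eq[OF ns _ that] by (auto simp: rel_iffs)
  have e: "?e \<in> star_set S (range Num)" by (rule germ_star_set) auto
  have t: "[j, ?e, htimes S j ?e] \<in> ext S times_rel" if "j \<in> hyperints S" for j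
    unfolding htimes_rel
    by (rule star_app2_mem[OF ns _ _ that[unfolded hyperints_def] e]) (auto simp: rel_iffs)
  have tu: "y = htimes S j ?e" if "[j, ?e, y] \<in> ext S times_rel" for j y
    unfolding htimes_rel using star_app2_eq[OF ns _ that] by (auto simp: rel_iffs)
  have "hcoord S i x \<in> grid1 S N0 \<longleftrightarrow> (\<exists>j. hcoord S i x = htimes S j ?e \<and> j \<in> hyperints S \<and>
      [gm (\<lambda>m. Num (- ((fact m)\<^sup>2))), j] \<in> ext S le_rel \<and> [j, gm (\<lambda>m. Num ((fact m)\<^sup>2))] \<in> ext S le_rel)"
    by (simp add: grid1_def grid_N_germ grid_eps_germ hfun_germ hle_rel)
  also have "\<dots> \<longleftrightarrow> ?R"
  proof
    assume "\<exists>j. hcoord S i x = htimes S j ?e \<and> j \<in> hyperints S \<and>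
      [gm (\<lambda>m. Num (- ((fact m)\<^sup>2))), j] \<in> ext S le_rel \<and> [j, gm (\<lambda>m. Num ((fact m)\<^sup>2))] \<in> ext S le_rel"
    then obtain j where j: "hcoord S i x = htimes S j ?e" "j \<in> hyperints S"
      "[gm (\<lambda>m. Num (- ((fact m)\<^sup>2))), j] \<in> ext S le_rel" "[j, gm (\<lambda>m. Num ((fact m)\<^sup>2))] \<in> ext S le_rel"
      by blast
    from j(2) have "[j] \<in> ext S (unary (Num ` \<int>))" by (simp add: hyperints_def star_set_iff unary_iff rel_iffs)
    with j(3,4) t[OF j(2)] c show ?R unfolding j(1) by blast
  next
    assume ?R
    then obtain j y where j: "[j] \<in> ext S (unary (Num ` \<int>))"
      "[gm (\<lambda>m. Num (- ((fact m)\<^sup>2))), j] \<in> ext S le_rel" "[j, gm (\<lambda>m. Num ((fact m)\<^sup>2))] \<in> ext S le_rel"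
      "[j, ?e, y] \<in> ext S times_rel" "[x, y] \<in> ext S (fun_pt_rel (\<lambda>p. p $ i))"
      by blast
    from j(1) have "j \<in> hyperints S" by (simp add: hyperints_def star_set_iff unary_iff rel_iffs)
    moreover have "hcoord S i x = htimes S j ?e" using cu[OF j(5)] tu[OF j(4)] by simp
    ultimately show "\<exists>j. hcoord S i x = htimes S j ?e \<and> j \<in> hyperints S \<and>
      [gm (\<lambda>m. Num (- ((fact m)\<^sup>2))), j] \<in> ext S le_rel \<and> [j, gm (\<lambda>m. Num ((fact m)\<^sup>2))] \<in> ext S le_rel"
      using j(2,3) by blast
  qed
  finally show ?thesis .
qed

lemma ex_Num_int_iff:
  "(\<exists>a. (\<exists>x\<in>\<int>. a = Num x) \<and> (\<exists>b. a = Num b \<and> A b) \<and> (\<exists>b. a = Num b \<and> B b) \<and>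
      (\<exists>b. a = Num b \<and> C b)) \<longleftrightarrow> (\<exists>j. j \<in> \<int> \<and> A j \<and> B j \<and> C j)"
  by auto

text \<open>At each standard index, membership in \<open>grid_points\<close> is a first-order
  condition on the point, with bounds and mesh as parameters. Carried to \<open>N0\<close>, it reads
  as membership in \<open>grid\<close>, which is thereby exhibited as a hyperfinite set.\<close>

lemma grid_iff: "x \<in> grid S N0 \<Omega> \<longleftrightarrow> [x, gridset \<Omega>] \<in> ext S mem_rel"
proof -
  \<comment> \<open>Coordinate indices are not objects of the universe, so the quantifier over them
    becomes a finite conjunction along \<open>ks\<close>.\<close>
  obtain ks :: "'k list" where ks: "set ks = UNIV" using finite_list[OF finite_class.finite_UNIV] by auto
  let ?P = "unary (Pt ` \<Omega>)"
  \<comment> \<open>Variables 0 to 4 hold these sequences; 5 is the point, 6 the integer numerator,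
    7 the coordinate.\<close>
  let ?Fs = "[\<lambda>m. Num (real m), \<lambda>m. PtSet (grid_points \<Omega> m), \<lambda>m. Num (- ((fact m)\<^sup>2)),
    \<lambda>m. Num ((fact m)\<^sup>2), \<lambda>m. Num (1 / fact m)] :: (nat \<Rightarrow> 'k obj) list"
  let ?q = "Conj (Atom ?P [5]) (Conjs (map (\<lambda>i. Ex 6 (Ex 7 (Conjs
    [Atom (unary (Num ` \<int>)) [6], Atom le_rel [2, 6], Atom le_rel [6, 3], Atom times_rel [6, 4, 7],
     Atom (fun_pt_rel (\<lambda>p. p $ i)) [5, 7]]))) ks))"
  let ?p = "All 5 (Conj (Imp (Atom mem_rel [5, 1]) ?q) (Imp ?q (Atom mem_rel [5, 1])))"
  have "sat (ext S) ?p (\<lambda>v. if v < length ?Fs then gm (?Fs ! v) else std S (Num 0))"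
  proof (rule germ_transfer)
    show "\<forall>\<^sub>F m in sequentially.
        sat (\<lambda>R. R) ?p (\<lambda>v. if v < length ?Fs then (?Fs ! v) m else Num 0)"
      by (rule always_eventually) (auto simp: ks grid_points_def grid_coords_iff image_iff unary_iff rel_iffs ex_Num_int_iff)
  qed auto
  note * = spec[OF this[unfolded sat.simps], of x, simplified, unfolded ks, simplified]
  have "[x, gridset \<Omega>] \<in> ext S mem_rel \<longleftrightarrow> x \<in> star_set S (Pt ` \<Omega>) \<and>
    (\<forall>i. \<exists>j y. [j] \<in> ext S (unary (Num ` \<int>)) \<and>
      [gm (\<lambda>m. Num (- ((fact m)\<^sup>2))), j] \<in> ext S le_rel \<and> [j, gm (\<lambda>m. Num ((fact m)\<^sup>2))] \<in> ext S le_rel \<and>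
      [j, gm (\<lambda>m. Num (1 / fact m)), y] \<in> ext S times_rel \<and>
      [x, y] \<in> ext S (fun_pt_rel (\<lambda>p. p $ i)))"
    unfolding star_set_iff using * by blast
  moreover have "x \<in> star_set S (range Pt)" if "x \<in> star_set S (Pt ` \<Omega>)"
    using transfer[OF ns, of "All 0 (Imp (Atom ?P [0]) (Atom (unary (range Pt)) [0]))" undefined]
      that by (auto simp: star_set_iff unary_iff rel_iffs)
  ultimately show ?thesis
    by (auto simp: grid_def hcoord_mem_grid1)
qed

lemma grid_Pt: "x \<in> grid S N0 \<Omega> \<Longrightarrow> x \<in> star_set S (range Pt)"
  unfolding grid_iff
  using transfer[OF ns, of "All 0 (All 1 (Imp (Atom mem_rel [0, 1]) (Atom (unary (range Pt)) [0])))"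
      undefined]
  by (auto simp: star_set_iff unary_iff rel_iffs)

section \<open>Internal functions and hyperfinite sums\<close>

definition eval_fun :: "'n \<Rightarrow> 'n \<Rightarrow> 'n" where
  "eval_fun c x = star_app S app_rel [c, x]"

lemma eval_fun_mem:
  "c \<in> star_set S (range Fun) \<Longrightarrow> x \<in> star_set S (range Pt) \<Longrightarrow> [c, x, eval_fun c x] \<in> ext S app_rel"
  unfolding eval_fun_def by (rule star_app2_mem[OF ns]) (auto simp: rel_iffs)

lemma eval_fun_eq: "[c, x, y] \<in> ext S app_rel \<Longrightarrow> eval_fun c x = y"
  unfolding eval_fun_def by (rule star_app2_eq[OF ns]) (auto simp: rel_iffs)

lemma germ_Fun: "gm (\<lambda>m. Fun (H m)) \<in> star_set S (range Fun)"
  by (rule germ_star_set) auto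

text \<open>A finite sum depends only on the members of the set and the values there, and this
  extensionality transfers. It makes the description in \<open>hyper_sum\<close> independent of the
  internal objects \<open>a\<close> and \<open>c\<close> chosen for set and function.\<close>

lemma sum_unique:
  assumes "a \<in> star_set S {PtSet F | F. finite F}" "a' \<in> star_set S {PtSet F | F. finite F}"
    and "c \<in> star_set S (range Fun)" "c' \<in> star_set S (range Fun)"
    and "\<And>x. [x, a] \<in> ext S mem_rel \<longleftrightarrow> [x, a'] \<in> ext S mem_rel"
    and "\<And>x y. [x, a] \<in> ext S mem_rel \<Longrightarrow> [c, x, y] \<in> ext S app_rel \<longleftrightarrow> [c', x, y] \<in> ext S app_rel"
    and "[a, c, s] \<in> ext S sum_rel"
  shows "[a', c', s] \<in> ext S sum_rel"
proof -
  let ?A = "unary {PtSet F | F. finite F}" and ?C = "unary (range Fun)"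
  let ?p = "All 0 (All 1 (All 2 (All 3 (All 4 (Imp (Conjs [Atom ?A [0], Atom ?A [1],
    Atom ?C [2], Atom ?C [3],
    All 5 (Conj (Imp (Atom mem_rel [5, 0]) (Atom mem_rel [5, 1])) (Imp (Atom mem_rel [5, 1]) (Atom mem_rel [5, 0]))),
    All 5 (All 6 (Imp (Atom mem_rel [5, 0]) (Conj (Imp (Atom app_rel [2, 5, 6]) (Atom app_rel [3, 5, 6]))
       (Imp (Atom app_rel [3, 5, 6]) (Atom app_rel [2, 5, 6]))))),
    Atom sum_rel [0, 2, 4]]) (Atom sum_rel [1, 3, 4]))))))"
  have "sat (\<lambda>R. R) ?p undefined"
  proof (simp, intro allI impI, elim conjE, goal_cases)
    case (1 a a' c c' s)
    then obtain F F' h h' where eq: "a = PtSet F" "a' = PtSet F'" "c = Fun h" "c' = Fun h'"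
      and fin: "finite F" "finite F'"
      by (auto simp: unary_iff)
    have "F = F'" using 1 by (auto simp: eq rel_iffs)
    moreover have "h p = h' p" if "p \<in> F" for p
      using 1(6)[THEN spec, of "Pt p", THEN mp, THEN spec, of "Num (h p)", THEN conjunct1] that
      by (simp add: eq rel_iffs)
    ultimately show ?case using 1 by (auto simp: eq rel_iffs)
  qed
  note * = transfer[OF ns, THEN iffD1, OF this, unfolded sat.simps sat_Imp sat_Conjs, 
    THEN spec[of _ a], THEN spec[of _ a'], THEN spec[of _ c], THEN spec[of _ c'], THEN spec[of _ s],
    simplified]
  show ?thesis
    using assms * unfolding star_set_iff by blast
qed

text \<open>The germs of the standard grids and of the functions \<open>Q m\<close> are admissible
  choices in \<open>hyper_sum\<close>, and for them the sum is computed index by index. Any other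
  admissible choice gives the same value by \<open>sum_unique\<close>.\<close>

lemma hyper_sum_germ:
  assumes rep: "represents S (gm (\<lambda>m. Fun (Q m))) (grid S N0 \<Omega>) F"
  shows "hyper_sum S (grid S N0 \<Omega>) F = gm (\<lambda>m. Num (\<Sum>p\<in>grid_points \<Omega> m. Q m p))"
proof -
  let ?c = "gm (\<lambda>m. Fun (Q m))" and ?a = "gridset \<Omega>"
  let ?s = "gm (\<lambda>m. Num (\<Sum>p\<in>grid_points \<Omega> m. Q m p))"
  have a: "?a \<in> star_set S {PtSet F | F. finite F}"
    by (rule germ_star_set) (simp add: finite_grid_points)
  have g: "{x. [x, ?a] \<in> ext S mem_rel} = grid S N0 \<Omega>" by (auto simp: grid_iff)
  have s: "[?a, ?c, ?s] \<in> ext S sum_rel"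
    using germ_rel[of "[\<lambda>m. PtSet (grid_points \<Omega> m), \<lambda>m. Fun (Q m),
      \<lambda>m. Num (\<Sum>p\<in>grid_points \<Omega> m. Q m p)]" sum_rel] by (simp add: finite_grid_points rel_iffs)
  have app: "star_app S sum_rel [a', c'] = ?s"
    if a': "a' \<in> star_set S {PtSet F | F. finite F}" and g': "{x. [x, a'] \<in> ext S mem_rel} = grid S N0 \<Omega>"
      and r: "represents S c' (grid S N0 \<Omega>) F" for a' c'
  proof -
    have c': "c' \<in> star_set S (range Fun)" using r by (simp add: represents_rel)
    have "[a', c', ?s] \<in> ext S sum_rel"
    proof (rule sum_unique[OF a a' germ_Fun c' _ _ s])
      show "[x, ?a] \<in> ext S mem_rel \<longleftrightarrow> [x, a'] \<in> ext S mem_rel" for x using g g' by blast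
      fix x y assume "[x, ?a] \<in> ext S mem_rel"
      then have x: "x \<in> grid S N0 \<Omega>" by (simp add: grid_iff)
      then have "eval_fun ?c x = eval_fun c' x"
        using r rep by (simp add: represents_rel eval_fun_def)
      then show "[?c, x, y] \<in> ext S app_rel \<longleftrightarrow> [c', x, y] \<in> ext S app_rel"
        using eval_fun_mem[OF germ_Fun grid_Pt[OF x], of Q] eval_fun_mem[OF c' grid_Pt[OF x]]
          eval_fun_eq by metis
    qed
    then show ?thesis by (intro star_app2_eq[OF ns]) (auto simp: rel_iffs)
  qed
  show ?thesis
    unfolding hyper_sum_rel
  proof (rule the_equality)
    show "\<exists>a c. a \<in> star_set S {PtSet F | F. finite F} \<and> {x. [x, a] \<in> ext S mem_rel} = grid S N0 \<Omega> \<and>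
        represents S c (grid S N0 \<Omega>) F \<and> ?s = star_app S sum_rel [a, c]"
      using a g rep app[OF a g rep, symmetric] by (intro exI conjI)
  next
    fix s assume "\<exists>a c. a \<in> star_set S {PtSet F | F. finite F} \<and> {x. [x, a] \<in> ext S mem_rel} = grid S N0 \<Omega> \<and>
        represents S c (grid S N0 \<Omega>) F \<and> s = star_app S sum_rel [a, c]"
    then show "s = ?s" using app by blast
  qed
qed

lemma grid_inner_germ:
  assumes "represents S (gm (\<lambda>m. Fun (Q m))) (grid S N0 \<Omega>) (\<lambda>x. htimes S (f x) (h x))"
  shows "grid_inner S N0 \<Omega> f h =
    gm (\<lambda>m. Num ((1 / fact m) ^ CARD('k) * (\<Sum>p\<in>grid_points \<Omega> m. Q m p)))"
  unfolding grid_inner_def hyper_sum_germ[OF assms] grid_eps_germ hfun_germ htimes_germ ..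

section \<open>The grid function and its pairings\<close>

definition grid_fun :: "(real ^ 'k) set \<Rightarrow> (nat \<Rightarrow> real ^ 'k \<Rightarrow> real) \<Rightarrow> 'n \<Rightarrow> 'n" where
  "grid_fun \<Omega> H = restrict (eval_fun (gm (\<lambda>m. Fun (H m)))) (grid S N0 \<Omega>)"

lemma eval_fun_hyperreal:
  assumes "x \<in> star_set S (range Pt)" and "c \<in> star_set S (range Fun)"
  shows "eval_fun c x \<in> star_set S (range Num)"
  using eval_fun_mem[OF assms(2,1)]
    transfer[OF ns, of "All 0 (All 1 (All 2 (Imp (Atom app_rel [0, 1, 2])
      (Atom (unary (range Num)) [2]))))" undefined]
  by (auto simp: star_set_iff unary_iff rel_iffs)

lemma grid_fun_in_grid_functions: "grid_fun \<Omega> H \<in> grid_functions S N0 \<Omega>"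
proof -
  have "represents S (gm (\<lambda>m. Fun (H m))) (grid S N0 \<Omega>) (grid_fun \<Omega> H)"
    by (simp add: represents_rel germ_Fun grid_fun_def eval_fun_def)
  moreover have "grid_fun \<Omega> H \<in> grid S N0 \<Omega> \<rightarrow>\<^sub>E hyperreals S"
    by (auto simp: grid_fun_def hyperreals_def intro!: eval_fun_hyperreal grid_Pt germ_Fun)
  ultimately show ?thesis
    by (auto simp: grid_functions_def internal_fun_on_def)
qed

lemma hfun_mem:
  "x \<in> star_set S (range Num) \<Longrightarrow> [x, hfun S g x] \<in> ext S (fun_rel g)"
  unfolding hfun_rel by (rule star_app1_mem[OF ns]) (auto simp: rel_iffs)

lemma hfun_pt_mem:
  "x \<in> star_set S (range Pt) \<Longrightarrow> [x, hfun_pt S g x] \<in> ext S (fun_pt_rel g)"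
  unfolding hfun_pt_rel by (rule star_app1_mem[OF ns]) (auto simp: rel_iffs)

lemma hfun_pt_hyperreal:
  "x \<in> star_set S (range Pt) \<Longrightarrow> hfun_pt S g x \<in> star_set S (range Num)"
  using hfun_pt_mem[of x g]
    transfer[OF ns, of "All 0 (All 1 (Imp (Atom (fun_pt_rel g) [0, 1])
      (Atom (unary (range Num)) [1])))" undefined]
  by (auto simp: star_set_iff unary_iff rel_iffs)

lemma hfun_hyperreal:
  "x \<in> star_set S (range Num) \<Longrightarrow> hfun S g x \<in> star_set S (range Num)"
  using hfun_mem[of x g]
    transfer[OF ns, of "All 0 (All 1 (Imp (Atom (fun_rel g) [0, 1])
      (Atom (unary (range Num)) [1])))" undefined]
  by (auto simp: star_set_iff unary_iff rel_iffs)

lemma hfun_id: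
  assumes "x \<in> star_set S (range Num)"
  shows "hfun S (\<lambda>a. a) x = x"
proof -
  have "[x, x] \<in> ext S (fun_rel (\<lambda>a. a))"
    using assms transfer[OF ns, of "All 0 (Imp (Atom (unary (range Num)) [0])
      (Atom (fun_rel (\<lambda>a. a)) [0, 0]))" undefined]
    by (auto simp: star_set_iff unary_iff rel_iffs)
  then show ?thesis unfolding hfun_rel by (intro star_app1_eq[OF ns]) (auto simp: rel_iffs)
qed

lemma htimes_mem:
  "x \<in> star_set S (range Num) \<Longrightarrow> y \<in> star_set S (range Num) \<Longrightarrow> [x, y, htimes S x y] \<in> ext S times_rel"
  unfolding htimes_rel by (rule star_app2_mem[OF ns]) (auto simp: rel_iffs)

text \<open>Composition with \<open>g\<close> and multiplication by \<open>\<phi>\<close> commute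
  with taking the value at \<open>N0\<close>, since the pointwise identity at each standard index is
  first-order. So the summand of the pairing is internal, with a representative whose hyperfinite
  sum is known.\<close>

lemma represents_grid_fun:
  "represents S (gm (\<lambda>m. Fun (\<lambda>p. g (H m p) * \<phi> p))) (grid S N0 \<Omega>)
    (\<lambda>x. htimes S (hfun S g (grid_fun \<Omega> H x)) (hfun_pt S \<phi> x))"
proof -
  let ?c = "gm (\<lambda>m. Fun (H m))" and ?c' = "gm (\<lambda>m. Fun (\<lambda>p. g (H m p) * \<phi> p))"
  let ?Fs = "[\<lambda>m. Num (real m), \<lambda>m. Fun (H m), \<lambda>m. Fun (\<lambda>p. g (H m p) * \<phi> p)]
    :: (nat \<Rightarrow> 'k obj) list"
  \<comment> \<open>Variable 3 is the point, 4 the sample, 5 and 6 the values of \<open>g\<close>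
    and \<open>\<phi>\<close>, 7 their product.\<close>
  let ?p = "All 3 (All 4 (All 5 (All 6 (All 7 (Imp (Conjs [Atom app_rel [1, 3, 4],
    Atom (fun_rel g) [4, 5], Atom (fun_pt_rel \<phi>) [3, 6],
    Atom times_rel [5, 6, 7]]) (Atom app_rel [2, 3, 7]))))))"
  have "sat (ext S) ?p (\<lambda>v. if v < length ?Fs then gm (?Fs ! v) else std S (Num 0))"
  proof (rule germ_transfer)
    show "\<forall>\<^sub>F m in sequentially.
        sat (\<lambda>R. R) ?p (\<lambda>v. if v < length ?Fs then (?Fs ! v) m else Num 0)"
      by (rule always_eventually) (auto simp: rel_iffs)
  qed auto
  then have *: "[?c', x, w] \<in> ext S app_rel"
    if "[?c, x, u] \<in> ext S app_rel" "[u, v] \<in> ext S (fun_rel g)"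
      "[x, v'] \<in> ext S (fun_pt_rel \<phi>)" "[v, v', w] \<in> ext S times_rel" for x u v v' w
    using that by simp
  have "htimes S (hfun S g (grid_fun \<Omega> H x)) (hfun_pt S \<phi> x) = eval_fun ?c' x"
    if x: "x \<in> grid S N0 \<Omega>" for x
  proof -
    have p: "x \<in> star_set S (range Pt)" using x by (rule grid_Pt)
    have u: "eval_fun ?c x \<in> star_set S (range Num)" by (rule eval_fun_hyperreal[OF p germ_Fun])
    show ?thesis
      using *[OF eval_fun_mem[OF germ_Fun p] hfun_mem[OF u] hfun_pt_mem[OF p]
          htimes_mem[OF hfun_hyperreal[OF u] hfun_pt_hyperreal[OF p]]] eval_fun_eq x
      by (simp add: grid_fun_def)
  qed
  then show ?thesis
    unfolding represents_rel by (simp add: germ_Fun eval_fun_def)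
qed

lemma approx_grid_inner:
  assumes "(\<lambda>m. (1 / fact m) ^ CARD('k) * (\<Sum>p\<in>grid_points \<Omega> m. g (H m p) * \<phi> p)) \<longlonglongrightarrow> l"
  shows "approx S (grid_inner S N0 \<Omega> (\<lambda>x. hfun S g (grid_fun \<Omega> H x)) (hfun_pt S \<phi>)) (std S (Num l))"
  unfolding grid_inner_germ[OF represents_grid_fun] by (rule approx_germ[OF assms])

lemma represents_cong:
  "(\<And>x. x \<in> A \<Longrightarrow> f x = f' x) \<Longrightarrow> represents S c A f \<longleftrightarrow> represents S c A f'"
  by (simp add: represents_rel)

text \<open>Lets the weak-star claim be treated as the case where \<open>\<gamma>\<close> is the
  identity. Agreement on the grid suffices, because \<open>hyper_sum\<close> sees its argument
  through \<open>represents\<close> alone.\<close>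

lemma grid_inner_id:
  "grid_inner S N0 \<Omega> (grid_fun \<Omega> H) h = grid_inner S N0 \<Omega> (\<lambda>x. hfun S (\<lambda>a. a) (grid_fun \<Omega> H x)) h"
proof -
  have "grid_fun \<Omega> H x = hfun S (\<lambda>a. a) (grid_fun \<Omega> H x)" if "x \<in> grid S N0 \<Omega>" for x
    using that hfun_id[OF eval_fun_hyperreal[OF grid_Pt[OF that] germ_Fun[of H]]]
    by (simp add: grid_fun_def)
  then have "represents S c (grid S N0 \<Omega>) (\<lambda>x. htimes S (grid_fun \<Omega> H x) (h x)) \<longleftrightarrow>
    represents S c (grid S N0 \<Omega>) (\<lambda>x. htimes S (hfun S (\<lambda>a. a) (grid_fun \<Omega> H x)) (h x))" for c
    by (intro represents_cong) simp
  then show ?thesis unfolding grid_inner_def hyper_sum_rel by simp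
qed

text \<open>That the samples differ somewhere on the grid is an existential first-order statement,
  so at \<open>N0\<close> it yields a point of the hyperfinite grid where the two functions
  differ.\<close>

lemma grid_fun_neq:
  assumes "\<forall>\<^sub>F m in sequentially. \<exists>p\<in>grid_points \<Omega> m. H m p \<noteq> H' m p"
  shows "grid_fun \<Omega> H \<noteq> grid_fun \<Omega> H'"
proof -
  let ?Fs = "[\<lambda>m. Num (real m), \<lambda>m. Fun (H m), \<lambda>m. Fun (H' m), \<lambda>m. PtSet (grid_points \<Omega> m)]
    :: (nat \<Rightarrow> 'k obj) list"
  let ?p = "Ex 4 (Conj (Atom mem_rel [4, 3]) (All 5 (Imp (Atom app_rel [1, 4, 5]) (Neg (Atom app_rel [2, 4, 5])))))"
  have "sat (ext S) ?p (\<lambda>v. if v < length ?Fs then gm (?Fs ! v) else std S (Num 0))"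
  proof (rule germ_transfer)
    show "\<forall>\<^sub>F m in sequentially.
        sat (\<lambda>R. R) ?p (\<lambda>v. if v < length ?Fs then (?Fs ! v) m else Num 0)"
      using assms
    proof eventually_elim
      case (elim m)
      then obtain p where "p \<in> grid_points \<Omega> m" "H m p \<noteq> H' m p" by blast
      then show ?case by (auto simp: rel_iffs intro!: exI[of _ "Pt p"])
    qed
  qed auto
  then obtain x where x: "[x, gridset \<Omega>] \<in> ext S mem_rel"
    and n: "\<And>y. [gm (\<lambda>m. Fun (H m)), x, y] \<in> ext S app_rel \<Longrightarrow> [gm (\<lambda>m. Fun (H' m)), x, y] \<notin> ext S app_rel"
    by auto
  from x have g: "x \<in> grid S N0 \<Omega>" by (simp add: grid_iff)
  have "grid_fun \<Omega> H x \<noteq> grid_fun \<Omega> H' x"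
    using n[OF eval_fun_mem[OF germ_Fun grid_Pt[OF g]]]
      eval_fun_mem[OF germ_Fun grid_Pt[OF g], of H'] g
    by (auto simp: grid_fun_def)
  then show ?thesis by metis
qed

end

section \<open>Existence and non-uniqueness of the grid function\<close>

theorem theorem3p1:
  fixes S :: "('k::finite, 'n) real_extension"
    and N0 :: 'n
    and \<Omega> :: "(real ^ 'k) set"
    and z :: "nat \<Rightarrow> real ^ 'k \<Rightarrow> real"
    and zinf :: "(real ^ 'k \<Rightarrow> real) \<Rightarrow> real"
    and \<nu> :: "real ^ 'k \<Rightarrow> real measure"
  assumes "open \<Omega>"
    and "nonstandard_extension S"
    and "saturated S (distributions \<Omega>)"
    and "infinite_hypernat S N0"
    and "bounded_L1_sequence \<Omega> z"
    and "weak_star_converges \<Omega> z zinf"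
    and "young_measure \<Omega> \<nu>"
    and "young_converges \<Omega> z \<nu>"
  shows "let Z = {f \<in> grid_functions S N0 \<Omega>.
           (\<forall>\<phi>\<in>C0c \<Omega>.
              approx S (grid_inner S N0 \<Omega> f (hfun_pt S \<phi>)) (std S (Num (zinf \<phi>)))) \<and>
           (\<forall>g\<in>C0b. \<forall>\<phi>\<in>C0c \<Omega>.
              approx S (grid_inner S N0 \<Omega> (\<lambda>x. hfun S g (f x)) (hfun_pt S \<phi>))
                (std S (Num (LINT x:\<Omega>|lebesgue. (\<integral>y. g y \<partial>\<nu> x) * \<phi> x))))}
         in (\<exists>f. f \<in> Z) \<and> (\<Omega> \<noteq> {} \<longrightarrow> (\<exists>f\<in>Z. \<exists>f'\<in>Z. f \<noteq> f'))"
proof -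
  interpret hyper S N0 by (unfold_locales) (rule assms)+
  obtain H where H: "\<And>c \<gamma> \<phi> l. c \<longlonglongrightarrow> 0 \<Longrightarrow> almost_lipschitz \<gamma> \<Longrightarrow> continuous_on UNIV \<gamma> \<Longrightarrow> \<phi> \<in> C0c \<Omega> \<Longrightarrow>
      (\<lambda>n. LINT x:\<Omega>|lebesgue. \<gamma> (z n x) * \<phi> x) \<longlonglongrightarrow> l \<Longrightarrow>
      (\<lambda>m. (1 / fact m) ^ CARD('k) * (\<Sum>x\<in>grid_points \<Omega> m. \<gamma> (H m x + c m) * \<phi> x)) \<longlonglongrightarrow> l"
    using grid_sampling[OF assms(5)] by blast
  define Z where "Z = {f \<in> grid_functions S N0 \<Omega>.
    (\<forall>\<phi>\<in>C0c \<Omega>. approx S (grid_inner S N0 \<Omega> f (hfun_pt S \<phi>)) (std S (Num (zinf \<phi>)))) \<and>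
    (\<forall>g\<in>C0b. \<forall>\<phi>\<in>C0c \<Omega>. approx S (grid_inner S N0 \<Omega> (\<lambda>x. hfun S g (f x)) (hfun_pt S \<phi>))
      (std S (Num (LINT x:\<Omega>|lebesgue. (\<integral>y. g y \<partial>\<nu> x) * \<phi> x))))}"
  \<comment> \<open>Every null perturbation of the samples gives a solution, which covers existence
    and non-uniqueness together.\<close>
  have Z: "grid_fun \<Omega> (\<lambda>m x. H m x + c m) \<in> Z" if c: "c \<longlonglongrightarrow> 0" for c
    unfolding Z_def mem_Collect_eq
  proof (intro conjI ballI grid_fun_in_grid_functions)
    fix \<phi> assume \<phi>: "\<phi> \<in> C0c \<Omega>"
    have "(\<lambda>n. LINT x:\<Omega>|lebesgue. z n x * \<phi> x) \<longlonglongrightarrow> zinf \<phi>"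
      using assms(6) \<phi> by (simp add: weak_star_converges_def)
    then show "approx S (grid_inner S N0 \<Omega> (grid_fun \<Omega> (\<lambda>m x. H m x + c m)) (hfun_pt S \<phi>))
        (std S (Num (zinf \<phi>)))"
      unfolding grid_inner_id
      by (intro approx_grid_inner H[OF c almost_lipschitz_id _ \<phi>]) simp_all
  next
    fix g \<phi> assume g: "g \<in> C0b" and \<phi>: "\<phi> \<in> C0c \<Omega>"
    have "(\<lambda>n. LINT x:\<Omega>|lebesgue. g (z n x) * \<phi> x) \<longlonglongrightarrow>
        (LINT x:\<Omega>|lebesgue. (\<integral>y. g y \<partial>\<nu> x) * \<phi> x)"
      using assms(8) g \<phi> by (simp add: young_converges_def)
    moreover have "continuous_on UNIV g" using g by (simp add: C0b_def)
    ultimately show "approx S (grid_inner S N0 \<Omega> (\<lambda>x. hfun S g (grid_fun \<Omega> (\<lambda>m x. H m x + c m) x))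
        (hfun_pt S \<phi>)) (std S (Num (LINT x:\<Omega>|lebesgue. (\<integral>y. g y \<partial>\<nu> x) * \<phi> x)))"
      by (intro approx_grid_inner H[OF c C0b_almost_lipschitz[OF g] _ \<phi>])
  qed
  \<comment> \<open>The summand 0 keeps the shape required by \<open>Z\<close>. The perturbation
    \<open>inverse (Suc m)\<close> is null but never zero, so the two families of samples differ at
    every grid point.\<close>
  let ?f = "grid_fun \<Omega> (\<lambda>m x. H m x + 0)" and ?f' = "grid_fun \<Omega> (\<lambda>m x. H m x + inverse (Suc m))"
  have "?f \<in> Z" using Z[OF tendsto_const] .
  moreover have "?f' \<in> Z" using Z[OF LIMSEQ_inverse_real_of_nat] .
  moreover have "?f \<noteq> ?f'" if "\<Omega> \<noteq> {}"
  proof (rule grid_fun_neq)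
    show "\<forall>\<^sub>F m in sequentially. \<exists>p\<in>grid_points \<Omega> m. H m p + 0 \<noteq> H m p + inverse (real (Suc m))"
      using grid_points_nonempty[OF assms(1) that] by eventually_elim (auto simp del: of_nat_Suc)
  qed
  ultimately have "(\<exists>f. f \<in> Z) \<and> (\<Omega> \<noteq> {} \<longrightarrow> (\<exists>f\<in>Z. \<exists>f'\<in>Z. f \<noteq> f'))" by blast
  then show ?thesis unfolding Let_def Z_def .
qed

end
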